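(* Let $\{a_n\}_{n\ge1}$ be the enumeration of $\mathbb{Z}+i\mathbb{Z}\subset\mathbb{C}_z$ given by the spiral $0 \to 1 \to 1+i \to i \to -1+i \to -1 \to -1-i \to -i \to 1-i \to 2-i \to 2 \to \cdots$. There exists a decreasing sequence $\{\varepsilon_n\}$ of positive numbers converging to zero such that, with $E_n := \{(z,w)\in\mathbb{C}^2 : w = \varepsilon_1\sqrt{z-a_1}+\cdots+\varepsilon_n\sqrt{z-a_n}\}$ (all $2^n$ branches of the multivalued right-hand side taken), the sets $E_n$ converge, in the Hausdorff metric on each compact subset of $\mathbb{C}^2$, to a nonempty unbounded connected closed set $\mathcal{E} = \{ b \in \mathbb{C}^2 : \exists\, b_n \in E_n,\ n=1,2,\dots,\ \text{with } b=\lim_{n\to\infty} b_n\}$, and the following holds: if $\phi$ is a continuous plurisubharmonic function defined on an open neighborhood $V\subset\mathbb{C}^2$ of $\mathcal{E}$ and $\phi$ is bounded from above, then $\phi\equiv C$ on $\mathcal{E}$ for some constant $C\in\mathbb{R}$.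
   Context: $E_n$ is the zero set of the polynomial $P_n(z,w)=\prod_{k=1}^{2^n}(w-w_k^{(n)}(z))$, where $w_1^{(n)}(z),\dots,w_{2^n}^{(n)}(z)$ are the $2^n$ values (with multiplicity) of $\sum_{k=1}^n\varepsilon_k\sqrt{z-a_k}$. The set $\mathcal{E}$ is called a Wermer type set. *)

theory Defs
  imports "HOL-Analysis.Analysis"
begin

text \<open>Square spiral enumeration of the Gaussian integers.
  The moves of the spiral come in runs j = 0,1,2,...; run j has length (j div 2 + 1)
  and direction i^j (i.e. right 1, up 1, left 2, down 2, right 3, up 3, ...).
  The n-th point (n >= 1) is the sum of the first n-1 moves.\<close>

definition spiral_moves :: "nat \<Rightarrow> complex list" where
  "spiral_moves N = concat (map (\<lambda>j. replicate (j div 2 + 1) (\<i> ^ j)) [0..<N])"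

definition spiral :: "nat \<Rightarrow> complex" where
  "spiral n = sum_list (take (n - 1) (spiral_moves n))"

definition wermer_E :: "(nat \<Rightarrow> complex) \<Rightarrow> (nat \<Rightarrow> real) \<Rightarrow> nat \<Rightarrow> (complex \<times> complex) set" where
  "wermer_E a eps n = {(z, w). \<exists>s :: nat \<Rightarrow> complex.
      (\<forall>k\<in>{1..n}. (s k)\<^sup>2 = z - a k) \<and> w = (\<Sum>k=1..n. complex_of_real (eps k) * s k)}"

definition wermer_limit :: "(nat \<Rightarrow> (complex \<times> complex) set) \<Rightarrow> (complex \<times> complex) set" where
  "wermer_limit E = {b. \<exists>bs. (\<forall>n\<ge>1. bs n \<in> E n) \<and> bs \<longlonglongrightarrow> b}"

definition local_hausdorff_tendsto ::
  "(nat \<Rightarrow> ('a::metric_space) set) \<Rightarrow> 'a set \<Rightarrow> bool" where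
  "local_hausdorff_tendsto E F \<longleftrightarrow>
     (\<forall>K. compact K \<longrightarrow> (\<forall>e>0. \<forall>\<^sub>F n in sequentially.
        (\<forall>x\<in>E n \<inter> K. \<exists>y\<in>F. dist x y < e) \<and> (\<forall>y\<in>F \<inter> K. \<exists>x\<in>E n. dist x y < e)))"

definition cline :: "complex \<times> complex \<Rightarrow> complex \<times> complex \<Rightarrow> complex \<Rightarrow> complex \<times> complex" where
  "cline p v \<zeta> = (fst p + \<zeta> * fst v, snd p + \<zeta> * snd v)"

text \<open>Continuous plurisubharmonic function on an open set V of C^2: continuous, and its
  restriction to every complex line is subharmonic, i.e. satisfies the sub-mean value
  inequality on every closed disc (in a complex line) contained in V.\<close>

definition cont_psh_on :: "(complex \<times> complex) set \<Rightarrow> (complex \<times> complex \<Rightarrow> real) \<Rightarrow> bool" where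
  "cont_psh_on V \<phi> \<longleftrightarrow> open V \<and> continuous_on V \<phi> \<and>
     (\<forall>p v. (\<forall>\<zeta>. cmod \<zeta> \<le> 1 \<longrightarrow> cline p v \<zeta> \<in> V) \<longrightarrow>
        \<phi> p \<le> integral {0..2*pi} (\<lambda>t. \<phi> (cline p v (cis t))) / (2*pi))"

end

(*
  The limit set X consists of all (z, sum_k e_k s_k) with s_k^2 = z - a_k for every k, provided the
  e_k decay fast enough. It is a union of Riemann surfaces (leaves), and each leaf is dense in X:
  running around a_k flips the sign of s_k alone, so a leaf reaches every point up to the choice of
  s_k for large k. A psh function phi bounded above attains its supremum on X, since otherwise
  phi - eta ln|z| would have a maximum over an annulus at an interior point of a leaf. By the strong
  maximum principle phi is constant on the leaf through a maximum, hence on X by density.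
  Connectedness of X follows from the same density of leaves.
*)

theory Submission
  imports Defs "HOL-Complex_Analysis.Complex_Analysis"
begin

subsection \<open>Maximum principles along holomorphic discs\<close>

text \<open>\<open>cont_psh_on\<close> speaks only about affine discs, whereas the leaves are
  curved, and \<phi> is merely continuous, so no Laplacian can be computed. The analytic half
  therefore establishes a comparison principle along holomorphic discs with a harmonic term Re g
  added to \<phi>: the choice of g supplies the barrier in the strong maximum principle, the
  logarithm in the Liouville argument, and zero for the final constancy. The geometric half never
  forms a leaf as a space. It works with sequences of roots s_k and with predicates on them that
  persist along chart discs: the open unit discs about the Gaussian integers cover the plane and
  each contains a single branch point, so explicit charts and walks on the lattice replace
  continuation along paths. The limit set is unbounded, but its part over a bounded disc is compact,
  which is why the supremum has to be forced inwards by a logarithm. The decay asked of the weights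
  is e_k (1 + |a_k|) \<le> 2^(-k); it makes the series of roots converge geometrically and uniformly
  over bounded z.\<close>

lemma holomorphic_circle_mean:
  fixes H :: "complex \<Rightarrow> complex"
  assumes hol: "H holomorphic_on ball 0 r" and s: "0 < s" "s < r"
  shows "((\<lambda>t. H (of_real s * cis t)) has_integral (2 * of_real pi * H 0)) {0..2*pi}"
proof -
  have "H holomorphic_on cball 0 s"
    by (rule holomorphic_on_subset[OF hol]) (use s in auto)
  then have "((\<lambda>u. H u / (u - 0)) has_contour_integral (2 * of_real pi * \<i> * H 0)) (circlepath 0 s)"
    by (rule Cauchy_integral_circlepath_simple) (use s in auto)
  then have "((\<lambda>t. H (of_real s * cis t) / (of_real s * cis t) * of_real s * \<i> * cis t)
      has_integral (2 * of_real pi * \<i> * H 0)) {0..2*pi}"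
    unfolding circlepath_def by (subst (asm) has_contour_integral_part_circlepath_iff) auto
  then have "((\<lambda>t. \<i> * H (of_real s * cis t)) has_integral (2 * of_real pi * \<i> * H 0)) {0..2*pi}"
    by (rule has_integral_eq[rotated]) (use s in \<open>auto simp: field_simps\<close>)
  from has_integral_mult_right[OF this, of "-\<i>"] show ?thesis
    by (rule has_integral_eq[THEN has_integral_eq_rhs, rotated]) (auto simp flip: mult.assoc)
qed

text \<open>Carrying Re g along turns the maximum principle into a comparison with harmonic
  functions on the disc, the form that all later uses take. A violation at the centre is made strict
  by a multiple of |\<zeta> - c|^2 and contradicted at an interior maximum of a regularised
  function.\<close>

lemma psh_max_principle:
  fixes f1 f2 g :: "complex \<Rightarrow> complex"
  assumes psh: "cont_psh_on V \<phi>"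
    and hol: "f1 holomorphic_on ball c R" "f2 holomorphic_on ball c R" "g holomorphic_on ball c R"
    and \<rho>: "0 < \<rho>" "\<rho> < R"
    and fV: "\<And>\<zeta>. \<zeta> \<in> cball c \<rho> \<Longrightarrow> (f1 \<zeta>, f2 \<zeta>) \<in> V"
    and bd: "\<And>\<zeta>. \<zeta> \<in> sphere c \<rho> \<Longrightarrow> \<phi> (f1 \<zeta>, f2 \<zeta>) + Re (g \<zeta>) \<le> B"
  shows "\<phi> (f1 c, f2 c) + Re (g c) \<le> B"
proof (rule ccontr)
  define f where "f \<zeta> = (f1 \<zeta>, f2 \<zeta>)" for \<zeta>
  define gap where "gap = \<phi> (f c) + Re (g c) - B"
  assume "\<not> ?thesis"
  then have gap: "gap > 0" by (simp add: gap_def f_def)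
  have opV: "open V" and contV: "continuous_on V \<phi>"
    and sub: "\<And>p v. (\<forall>\<zeta>. cmod \<zeta> \<le> 1 \<longrightarrow> cline p v \<zeta> \<in> V) \<Longrightarrow>
        \<phi> p \<le> integral {0..2*pi} (\<lambda>t. \<phi> (cline p v (cis t))) / (2*pi)"
    using psh unfolding cont_psh_on_def by blast+
  define D where "D = cball c \<rho>"
  have DR: "D \<subseteq> ball c R" using \<rho> by (auto simp: D_def)
  have cf: "continuous_on D f" unfolding f_def
    by (intro continuous_on_Pair holomorphic_on_imp_continuous_on holomorphic_on_subset[OF hol(1) DR]
        holomorphic_on_subset[OF hol(2) DR])
  have cg: "continuous_on D g"
    by (intro holomorphic_on_imp_continuous_on holomorphic_on_subset[OF hol(3) DR])
  have cD: "compact D" and Dne: "D \<noteq> {}" using \<rho> by (auto simp: D_def)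
  define K where "K = f ` D"
  have cK: "compact K" unfolding K_def using cf cD by (rule compact_continuous_image)
  have KV: "K \<subseteq> V" using fV by (auto simp: K_def f_def D_def)
  obtain d where d: "d > 0" "(\<Union>x\<in>K. ball x d) \<subseteq> V"
    using compact_subset_open_imp_ball_epsilon_subset[OF cK opV KV] by blast
  \<comment> \<open>A compact neighbourhood of the disc inside V: \<phi> has to be defined and
    uniformly continuous at the displaced points f(\<zeta>) + y.\<close>
  define K2 where "K2 = {x + y |x y. x \<in> K \<and> y \<in> cball 0 (d/2)}"
  have cK2: "compact K2" unfolding K2_def by (intro compact_sums cK compact_cball)
  have K2V: "K2 \<subseteq> V"
  proof
    fix p assume "p \<in> K2"
    then obtain x y where "p = x + y" "x \<in> K" "norm y \<le> d/2" by (auto simp: K2_def)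
    then have "p \<in> ball x d" using d(1) by (simp add: dist_norm)
    then show "p \<in> V" using d(2) \<open>x \<in> K\<close> by blast
  qed
  have "uniformly_continuous_on K2 \<phi>"
    using cK2 continuous_on_subset[OF contV K2V] by (rule compact_uniformly_continuous[rotated])
  then obtain e0 where e0: "e0 > 0"
      "\<And>x y. x \<in> K2 \<Longrightarrow> y \<in> K2 \<Longrightarrow> dist y x < e0 \<Longrightarrow> dist (\<phi> y) (\<phi> x) < gap / 3"
    unfolding uniformly_continuous_on_def using gap by (metis zero_less_divide_iff zero_less_numeral)
  define e where "e = min (d/2) (e0/2)"
  have e: "e > 0" "e \<le> d/2" "e < e0" using d(1) e0(1) by (auto simp: e_def)
  have inK2: "f \<zeta> + y \<in> K2" if "\<zeta> \<in> D" "norm y \<le> e" for \<zeta> y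
  proof -
    have "f \<zeta> \<in> K" "y \<in> cball 0 (d/2)" using that e(2) by (auto simp: K_def)
    then show ?thesis unfolding K2_def by blast
  qed
  have osc: "\<phi> (f \<zeta> + y) < \<phi> (f \<zeta>) + gap / 3" if "\<zeta> \<in> D" "norm y \<le> e" for \<zeta> y
  proof -
    have "dist (\<phi> (f \<zeta> + y)) (\<phi> (f \<zeta>)) < gap / 3"
      using inK2[OF that] inK2[OF that(1), of 0] that(2) e by (intro e0(2)) (auto simp: dist_norm)
    then show ?thesis unfolding dist_real_def by linarith
  qed
  have "continuous_on D (\<lambda>\<zeta>. \<phi> (f \<zeta>) + Re (g \<zeta>))"
    using KV by (intro continuous_intros cg continuous_on_compose2[OF contV cf]) (auto simp: K_def)
  then obtain \<zeta>M where \<zeta>M: "\<And>\<zeta>. \<zeta> \<in> D \<Longrightarrow> \<phi> (f \<zeta>) + Re (g \<zeta>) \<le> \<phi> (f \<zeta>M) + Re (g \<zeta>M)"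
    using continuous_attains_sup[OF cD Dne] by blast
  define M1 where "M1 = \<phi> (f \<zeta>M) + Re (g \<zeta>M)"
  define D0 where "D0 = \<phi> (f c) + Re (g c)"
  \<comment> \<open>Sized so that at |y| = e the penalty L |y|^2 outweighs whatever \<phi> + Re g
    can gain over its value at the centre; the maximum below then has |y| < e.\<close>
  define L where "L = (\<bar>M1\<bar> + \<bar>D0\<bar> + gap) / e\<^sup>2"
  have L: "L > 0" "L * e\<^sup>2 = \<bar>M1\<bar> + \<bar>D0\<bar> + gap" using gap e by (auto simp: L_def)
  \<comment> \<open>The excess \<open>gap\<close> is split into thirds: one for the oscillation of
    \<phi> under displacements, one for this term on D, and one is left to exclude a maximum on the
    boundary circle. Strict subharmonicity of \<kappa> |\<zeta> - c|^2 gives the final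
    contradiction.\<close>
  define \<kappa> where "\<kappa> = gap / (3 * \<rho>\<^sup>2)"
  have \<kappa>: "\<kappa> > 0" "\<kappa> * \<rho>\<^sup>2 = gap / 3" using gap \<rho> by (auto simp: \<kappa>_def)
  \<comment> \<open>Maximising over \<open>y\<close> as well regularises \<open>\<phi>\<close> by sup-convolution: at a maximum the quadratic part
    of \<open>f\<close> can be absorbed into \<open>y\<close>, so the sub-mean value inequality is needed only on complex lines.\<close>
  define \<Psi> where "\<Psi> = (\<lambda>(\<zeta>, y). \<phi> (f \<zeta> + y) - L * (norm y)\<^sup>2 + Re (g \<zeta>) + \<kappa> * (cmod (\<zeta> - c))\<^sup>2)"
  have "continuous_on (D \<times> cball 0 e) \<Psi>"
    unfolding \<Psi>_def case_prod_unfold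
    using inK2 K2V
    by (intro continuous_intros continuous_on_compose2[OF contV] continuous_on_compose2[OF cf]
        continuous_on_compose2[OF cg]) auto
  moreover have "compact (D \<times> cball (0::complex\<times>complex) e)" by (intro compact_Times cD compact_cball)
  moreover have "D \<times> cball (0::complex\<times>complex) e \<noteq> {}" using e \<rho> by (auto simp: D_def)
  ultimately obtain m where m: "m \<in> D \<times> cball 0 e" "\<forall>x \<in> D \<times> cball 0 e. \<Psi> x \<le> \<Psi> m"
    using continuous_attains_sup[of "D \<times> cball 0 e" \<Psi>] by blast
  obtain \<zeta> y where my: "m = (\<zeta>, y)" by (cases m) blast
  have \<zeta>y: "\<zeta> \<in> D" "norm y \<le> e"
    and mx: "\<And>\<zeta>' y'. \<zeta>' \<in> D \<Longrightarrow> norm y' \<le> e \<Longrightarrow> \<Psi> (\<zeta>', y') \<le> \<Psi> (\<zeta>, y)"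
    using m my by auto
  have "D0 = \<Psi> (c, 0)" by (simp add: \<Psi>_def D0_def)
  also have "\<dots> \<le> \<Psi> (\<zeta>, y)" using \<rho> e by (intro mx) (auto simp: D_def)
  finally have D0: "D0 \<le> \<phi> (f \<zeta> + y) - L * (norm y)\<^sup>2 + Re (g \<zeta>) + \<kappa> * (cmod (\<zeta> - c))\<^sup>2"
    by (simp add: \<Psi>_def)
  have "(cmod (\<zeta> - c))\<^sup>2 \<le> \<rho>\<^sup>2"
    using \<zeta>y(1) by (intro power_mono) (auto simp: D_def dist_norm norm_minus_commute)
  then have k2: "\<kappa> * (cmod (\<zeta> - c))\<^sup>2 \<le> gap / 3" using \<kappa> by (metis mult_left_mono less_imp_le)
  have up: "D0 < \<phi> (f \<zeta>) + Re (g \<zeta>) - L * (norm y)\<^sup>2 + 2 * gap / 3"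
    using D0 osc[OF \<zeta>y] k2 by linarith
  have y: "norm y < e"
  proof (rule ccontr)
    assume "\<not> norm y < e"
    then have "norm y = e" using \<zeta>y(2) by simp
    then have "D0 < M1 - (\<bar>M1\<bar> + \<bar>D0\<bar> + gap) + 2 * gap / 3"
      using up \<zeta>M[OF \<zeta>y(1)] L(2) by (simp add: M1_def)
    then show False using gap by linarith
  qed
  have \<zeta>: "cmod (\<zeta> - c) < \<rho>"
  proof (rule ccontr)
    assume "\<not> cmod (\<zeta> - c) < \<rho>"
    then have "\<zeta> \<in> sphere c \<rho>" using \<zeta>y(1) by (auto simp: D_def dist_norm norm_minus_commute)
    then have "\<phi> (f \<zeta>) + Re (g \<zeta>) \<le> B" using bd by (simp add: f_def)
    moreover have "L * (norm y)\<^sup>2 \<ge> 0" using L by simp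
    ultimately have "D0 < B + 2 * gap / 3" using up by linarith
    moreover have "D0 = B + gap" by (simp add: D0_def gap_def)
    ultimately show False using gap by linarith
  qed
  define v1 where "v1 = deriv f1 \<zeta>"
  define v2 where "v2 = deriv f2 \<zeta>"
  define G1 where "G1 \<eta> = f1 (\<zeta> + \<eta>) - f1 \<zeta> - \<eta> * v1" for \<eta>
  define G2 where "G2 \<eta> = f2 (\<zeta> + \<eta>) - f2 \<zeta> - \<eta> * v2" for \<eta>
  \<comment> \<open>Makes 2 L \<mu>^2 = \<kappa>/2: the squared Taylor remainders of the two
    components, together at most 2 \<mu>^2 |\<eta>|^2, use up only half of the \<kappa>
    term.\<close>
  define \<mu> where "\<mu> = sqrt (\<kappa> / (4 * L))"
  have \<mu>: "\<mu> > 0" "\<mu>\<^sup>2 = \<kappa> / (4 * L)" using \<kappa> L by (auto simp: \<mu>_def)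
  have \<zeta>R: "\<zeta> \<in> ball c R" using \<zeta>y(1) DR by blast
  have small: "\<exists>d>0. \<forall>\<eta>. cmod \<eta> < d \<longrightarrow> cmod (h (\<zeta> + \<eta>) - h \<zeta> - \<eta> * deriv h \<zeta>) \<le> \<mu> * cmod \<eta>"
    if h: "h holomorphic_on ball c R" for h
  proof -
    have "(h has_field_derivative deriv h \<zeta>) (at \<zeta>)"
      using h \<zeta>R by (intro holomorphic_derivI[of _ "ball c R"]) auto
    then obtain d where "d > 0" and
       d: "\<And>x. norm (x - \<zeta>) < d \<Longrightarrow> norm (h x - h \<zeta> - deriv h \<zeta> * (x - \<zeta>)) \<le> \<mu> * norm (x - \<zeta>)"
      unfolding has_field_derivative_def has_derivative_at_alt using \<mu>(1) by blast
    show ?thesis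
    proof (intro exI[of _ d] conjI allI impI)
      fix \<eta> :: complex assume "cmod \<eta> < d"
      then show "cmod (h (\<zeta> + \<eta>) - h \<zeta> - \<eta> * deriv h \<zeta>) \<le> \<mu> * cmod \<eta>"
        using d[of "\<zeta> + \<eta>"] by (simp add: mult.commute)
    qed fact
  qed
  obtain d1 where d1: "d1 > 0" "\<And>\<eta>. cmod \<eta> < d1 \<Longrightarrow> cmod (G1 \<eta>) \<le> \<mu> * cmod \<eta>"
    using small[OF hol(1)] unfolding G1_def v1_def by blast
  obtain d2 where d2: "d2 > 0" "\<And>\<eta>. cmod \<eta> < d2 \<Longrightarrow> cmod (G2 \<eta>) \<le> \<mu> * cmod \<eta>"
    using small[OF hol(2)] unfolding G2_def v2_def by blast
  have "0 < Min {d1, d2, (e - norm y) / (2 * \<mu>), \<rho> - cmod (\<zeta> - c)}"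
    using d1(1) d2(1) y \<mu>(1) \<zeta> by simp
  \<comment> \<open>The third bound keeps the displacement below within e, as the two remainders add
    up to at most 2 \<mu> s; the last keeps \<zeta> + \<eta> in D.\<close>
  then obtain s where s0: "0 < s" "s < Min {d1, d2, (e - norm y) / (2 * \<mu>), \<rho> - cmod (\<zeta> - c)}"
    using dense by blast
  then have s: "0 < s" "s < d1" "s < d2" "s < (e - norm y) / (2 * \<mu>)" "s < \<rho> - cmod (\<zeta> - c)"
    by simp_all
  define q where "q = f \<zeta> + y"
  \<comment> \<open>Collects the terms of the comparison that are real parts of holomorphic
    functions of \<eta> vanishing at 0, so that they average out over a circle. \<open>G1\<close>
    and \<open>G2\<close> enter linearly, through the cross term of the squared
    displacement.\<close>
  define H where "H \<eta> = - (2 * of_real L) * (cnj (fst y) * G1 \<eta> + cnj (snd y) * G2 \<eta>)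
      - (g (\<zeta> + \<eta>) - g \<zeta>) - 2 * of_real \<kappa> * cnj (\<zeta> - c) * \<eta>" for \<eta>
  have key: "(fst q + \<eta> * v1, snd q + \<eta> * v2) \<in> V \<and>
      \<phi> (fst q + \<eta> * v1, snd q + \<eta> * v2) \<le> \<phi> q + Re (H \<eta>) + (2 * L * \<mu>\<^sup>2 - \<kappa>) * (cmod \<eta>)\<^sup>2"
    if \<eta>: "cmod \<eta> \<le> s" for \<eta>
  proof -
    \<comment> \<open>Subtracting the Taylor remainder from y puts f(\<zeta> + \<eta>) + y' exactly
      on the complex line q + \<eta> (v1, v2).\<close>
    define y' where "y' = (fst y - G1 \<eta>, snd y - G2 \<eta>)"
    have g1: "cmod (G1 \<eta>) \<le> \<mu> * cmod \<eta>" using d1(2) s \<eta> by auto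
    have g2: "cmod (G2 \<eta>) \<le> \<mu> * cmod \<eta>" using d2(2) s \<eta> by auto
    have "norm (G1 \<eta>, G2 \<eta>) \<le> cmod (G1 \<eta>) + cmod (G2 \<eta>)" by (rule norm_Pair_le)
    also have "\<dots> \<le> 2 * \<mu> * s"
      using g1 g2 mult_left_mono[OF \<eta>, of \<mu>] \<mu>(1) by linarith
    also have "\<dots> \<le> e - norm y" using s(4) \<mu>(1) by (simp add: field_simps)
    finally have "norm (G1 \<eta>, G2 \<eta>) \<le> e - norm y" .
    moreover have "y' = y - (G1 \<eta>, G2 \<eta>)" by (simp add: y'_def prod_eq_iff)
    ultimately have y': "norm y' \<le> e" using norm_triangle_ineq4[of y "(G1 \<eta>, G2 \<eta>)"] by simp
    have \<zeta>\<eta>: "\<zeta> + \<eta> \<in> D"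
      using \<eta> s(5) norm_triangle_ineq[of "\<zeta> - c" \<eta>]
      by (simp add: D_def dist_norm norm_minus_commute algebra_simps)
    have qq: "f (\<zeta> + \<eta>) + y' = (fst q + \<eta> * v1, snd q + \<eta> * v2)"
      by (simp add: q_def f_def y'_def G1_def G2_def prod_eq_iff)
    have inV: "(fst q + \<eta> * v1, snd q + \<eta> * v2) \<in> V"
      using inK2[OF \<zeta>\<eta> y'] K2V qq by auto
    note mx[OF \<zeta>\<eta> y', unfolded \<Psi>_def case_prod_conv qq, folded q_def]
    then have 1: "\<phi> (fst q + \<eta> * v1, snd q + \<eta> * v2) \<le> \<phi> q
        + L * ((norm y')\<^sup>2 - (norm y)\<^sup>2) - Re (g (\<zeta> + \<eta>) - g \<zeta>)
        - \<kappa> * ((cmod (\<zeta> + \<eta> - c))\<^sup>2 - (cmod (\<zeta> - c))\<^sup>2)"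
      by (simp add: algebra_simps)
    have sq: "(cmod (a - b))\<^sup>2 = (cmod a)\<^sup>2 - 2 * Re (cnj a * b) + (cmod b)\<^sup>2" for a b
      unfolding cmod_power2 by (simp add: power2_eq_square algebra_simps)
    have n2: "(norm p)\<^sup>2 = (cmod (fst p))\<^sup>2 + (cmod (snd p))\<^sup>2" for p :: "complex \<times> complex"
      by (simp add: norm_prod_def)
    define Y where "Y = Re (cnj (fst y) * G1 \<eta> + cnj (snd y) * G2 \<eta>)"
    define Z where "Z = Re (cnj (\<zeta> - c) * \<eta>)"
    have "(norm y')\<^sup>2 - (norm y)\<^sup>2 = - 2 * Y
        + ((cmod (G1 \<eta>))\<^sup>2 + (cmod (G2 \<eta>))\<^sup>2)"
      unfolding n2 y'_def fst_conv snd_conv sq Y_def by simp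
    also have "\<dots> \<le> - 2 * Y + 2 * \<mu>\<^sup>2 * (cmod \<eta>)\<^sup>2"
      using power_mono[OF g1, of 2] power_mono[OF g2, of 2] by (simp add: power_mult_distrib)
    finally have "L * ((norm y')\<^sup>2 - (norm y)\<^sup>2) \<le>
        L * (- 2 * Y + 2 * \<mu>\<^sup>2 * (cmod \<eta>)\<^sup>2)"
      using L(1) by (intro mult_left_mono) auto
    moreover
    have "(cmod (\<zeta> + \<eta> - c))\<^sup>2 = (cmod (\<zeta> - c))\<^sup>2 + 2 * Z + (cmod \<eta>)\<^sup>2"
      using sq[of "\<zeta> - c" "- \<eta>"] unfolding Z_def by (simp add: algebra_simps)
    then have "\<kappa> * ((cmod (\<zeta> + \<eta> - c))\<^sup>2 - (cmod (\<zeta> - c))\<^sup>2) = \<kappa> * (2 * Z + (cmod \<eta>)\<^sup>2)" by simp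
    moreover have "Re (H \<eta>) = - 2 * L * Y
        - Re (g (\<zeta> + \<eta>) - g \<zeta>) - 2 * \<kappa> * Z"
      by (simp add: H_def Y_def Z_def algebra_simps)
    ultimately have "\<phi> (fst q + \<eta> * v1, snd q + \<eta> * v2) \<le> \<phi> q + Re (H \<eta>) + (2 * L * \<mu>\<^sup>2 - \<kappa>) * (cmod \<eta>)\<^sup>2"
      using 1 by (simp add: algebra_simps)
    then show ?thesis using inV by blast
  qed
  define R' where "R' = R - cmod (\<zeta> - c)"
  have shift: "(\<lambda>\<eta>. h (\<zeta> + \<eta>)) holomorphic_on ball 0 R'" if "h holomorphic_on ball c R" for h
  proof -
    have "(\<lambda>\<eta>. \<zeta> + \<eta>) ` ball 0 R' \<subseteq> ball c R"
    proof (rule image_subsetI)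
      fix \<eta> :: complex assume "\<eta> \<in> ball 0 R'"
      then show "\<zeta> + \<eta> \<in> ball c R"
        using norm_triangle_ineq[of "\<zeta> - c" \<eta>]
        by (simp add: dist_norm R'_def norm_minus_commute[of c] algebra_simps)
    qed
    from holomorphic_on_compose_gen[OF _ that this] show ?thesis
      by (simp add: o_def holomorphic_intros)
  qed
  have "H holomorphic_on ball 0 R'"
    unfolding H_def G1_def G2_def by (intro holomorphic_intros shift hol)
  moreover have "s < R'" using s(5) \<rho> by (simp add: R'_def)
  ultimately have "((\<lambda>t. H (of_real s * cis t)) has_integral (2 * of_real pi * H 0)) {0..2*pi}"
    using s(1) by (intro holomorphic_circle_mean)
  moreover have "H 0 = 0" by (simp add: H_def G1_def G2_def)
  ultimately have "((\<lambda>t. H (of_real s * cis t)) has_integral 0) {0..2*pi}" by simp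
  from has_integral_Re[OF this]
  have IH: "((\<lambda>t. Re (H (of_real s * cis t))) has_integral 0) {0..2*pi}" by simp
  have "((\<lambda>t. Re (H (of_real s * cis t)) + (\<phi> q + (2 * L * \<mu>\<^sup>2 - \<kappa>) * s\<^sup>2)) has_integral
      (0 + (2 * pi - 0) *\<^sub>R (\<phi> q + (2 * L * \<mu>\<^sup>2 - \<kappa>) * s\<^sup>2))) {0..2*pi}"
    by (intro has_integral_add IH has_integral_const_real[THEN has_integral_eq_rhs]) auto
  then have I: "((\<lambda>t. Re (H (of_real s * cis t)) + (\<phi> q + (2 * L * \<mu>\<^sup>2 - \<kappa>) * s\<^sup>2)) has_integral
      (2 * pi * (\<phi> q + (2 * L * \<mu>\<^sup>2 - \<kappa>) * s\<^sup>2))) {0..2*pi}" by simp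
  define v where "v = (of_real s * v1, of_real s * v2)"
  have cl: "cline q v \<omega> = (fst q + (of_real s * \<omega>) * v1, snd q + (of_real s * \<omega>) * v2)" for \<omega>
    by (simp add: cline_def v_def mult_ac)
  have clV: "cline q v \<omega> \<in> V" if "cmod \<omega> \<le> 1" for \<omega>
    unfolding cl using key[of "of_real s * \<omega>"] that s(1) by (simp add: norm_mult)
  have "(\<lambda>t. \<phi> (cline q v (cis t))) integrable_on {0..2*pi}"
  proof (rule integrable_continuous_real, rule continuous_on_compose2[OF contV])
    show "continuous_on {0..2*pi} (\<lambda>t. cline q v (cis t))"
      unfolding cline_def by (intro continuous_intros)
  qed (use clV in auto)
  moreover have "\<phi> (cline q v (cis t)) \<le> Re (H (of_real s * cis t)) + (\<phi> q + (2 * L * \<mu>\<^sup>2 - \<kappa>) * s\<^sup>2)" for t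
    unfolding cl using key[of "of_real s * cis t"] s(1) by (simp add: norm_mult)
  ultimately have "integral {0..2*pi} (\<lambda>t. \<phi> (cline q v (cis t))) \<le> 2 * pi * (\<phi> q + (2 * L * \<mu>\<^sup>2 - \<kappa>) * s\<^sup>2)"
    by (intro has_integral_le[OF integrable_integral I]) blast+
  moreover have "2 * pi * \<phi> q \<le> integral {0..2*pi} (\<lambda>t. \<phi> (cline q v (cis t)))"
    using sub[of q v] clV by (simp add: field_simps)
  ultimately have "2 * pi * \<phi> q \<le> 2 * pi * (\<phi> q + (2 * L * \<mu>\<^sup>2 - \<kappa>) * s\<^sup>2)" by linarith
  then have "0 \<le> (2 * L * \<mu>\<^sup>2 - \<kappa>) * s\<^sup>2" by simp
  moreover have "2 * L * \<mu>\<^sup>2 - \<kappa> < 0" using \<mu>(2) L(1) \<kappa>(1) by (simp add: field_simps)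
  ultimately show False using s(1) by (simp add: zero_le_mult_iff)
qed

text \<open>The contact set is closed by continuity and open by Hopf's boundary point argument.
  Averaging would ask for a mean value inequality along the curved disc, whereas
  \<open>psh_max_principle\<close> provides comparison with harmonic functions, which a logarithmic
  barrier exploits.\<close>

lemma psh_strong_max_principle:
  fixes f1 f2 g :: "complex \<Rightarrow> complex"
  assumes psh: "cont_psh_on V \<phi>"
    and hol: "f1 holomorphic_on U" "f2 holomorphic_on U" "g holomorphic_on U"
    and U: "open U" "connected U"
    and fV: "\<And>\<zeta>. \<zeta> \<in> U \<Longrightarrow> (f1 \<zeta>, f2 \<zeta>) \<in> V"
    and le: "\<And>\<zeta>. \<zeta> \<in> U \<Longrightarrow> \<phi> (f1 \<zeta>, f2 \<zeta>) + Re (g \<zeta>) \<le> C"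
    and p: "p \<in> U" "\<phi> (f1 p, f2 p) + Re (g p) = C"
    and q: "q \<in> U"
  shows "\<phi> (f1 q, f2 q) + Re (g q) = C"
proof -
  define v where "v \<zeta> = \<phi> (f1 \<zeta>, f2 \<zeta>) + Re (g \<zeta>)" for \<zeta>
  have contV: "continuous_on V \<phi>" using psh unfolding cont_psh_on_def by blast
  have cv: "continuous_on U v" unfolding v_def
    using fV by (intro continuous_intros continuous_on_compose2[OF contV]
        holomorphic_on_imp_continuous_on hol) auto
  define A where "A = {\<zeta> \<in> U. v \<zeta> = C}"
  have clo: "closedin (top_of_set U) A"
    unfolding A_def by (rule continuous_closedin_preimage_constant[OF cv])
  have "\<exists>t>0. ball \<zeta>0 t \<subseteq> A" if \<zeta>0: "\<zeta>0 \<in> A" for \<zeta>0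
  proof -
    have "\<zeta>0 \<in> U" using \<zeta>0 by (simp add: A_def)
    then obtain t0 where t0: "t0 > 0" "cball \<zeta>0 t0 \<subseteq> U" using U(1) open_contains_cball by blast
    \<comment> \<open>One third, so that the contact point nearest to \<zeta>1 and the small discs
      around it remain in U.\<close>
    define t where "t = t0 / 3"
    have t: "t > 0" "cball \<zeta>0 (2 * t) \<subseteq> U" "cball \<zeta>0 (3 * t) \<subseteq> U" using t0 by (auto simp: t_def)
    have "ball \<zeta>0 t \<subseteq> A"
    proof (rule ccontr)
      assume "\<not> ball \<zeta>0 t \<subseteq> A"
      then obtain \<zeta>1 where \<zeta>1: "\<zeta>1 \<in> ball \<zeta>0 t" "\<zeta>1 \<notin> A" by blast
      define A' where "A' = A \<inter> cball \<zeta>0 (2 * t)"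
      have "compact A'"
      proof -
        have "A' = {\<zeta> \<in> cball \<zeta>0 (2 * t). v \<zeta> = C}" using t(2) by (auto simp: A'_def A_def)
        moreover have "closed {\<zeta> \<in> cball \<zeta>0 (2 * t). v \<zeta> = C}"
          by (rule continuous_closed_preimage_constant[OF continuous_on_subset[OF cv t(2)]]) auto
        ultimately show ?thesis
          unfolding compact_eq_bounded_closed using bounded_subset[OF bounded_cball, of A' \<zeta>0 "2 * t"]
          by (auto simp: A'_def)
      qed
      moreover have "\<zeta>0 \<in> A'" using \<zeta>0 t by (simp add: A'_def)
      ultimately obtain \<xi> where \<xi>: "\<xi> \<in> A'" "\<And>x. x \<in> A' \<Longrightarrow> dist \<zeta>1 \<xi> \<le> dist \<zeta>1 x"
        using distance_attains_inf[of A' \<zeta>1] compact_imp_closed by blast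
      define \<rho> where "\<rho> = dist \<zeta>1 \<xi> / 2"
      have "\<zeta>1 \<noteq> \<xi>" using \<xi>(1) \<zeta>1 by (auto simp: A'_def)
      then have \<rho>0: "\<rho> > 0" by (simp add: \<rho>_def)
      have \<rho>t: "2 * \<rho> < t"
        using \<xi>(2)[OF \<open>\<zeta>0 \<in> A'\<close>] \<zeta>1(1) by (simp add: \<rho>_def dist_commute)
      have away: "x \<notin> A" if "dist \<zeta>1 x < 2 * \<rho>" for x
      proof
        assume "x \<in> A"
        moreover have "dist \<zeta>0 x \<le> 2 * t"
          using dist_triangle[of \<zeta>0 x \<zeta>1] \<zeta>1(1) that \<rho>t by simp
        ultimately have "x \<in> A'" by (simp add: A'_def)
        then show False using \<xi>(2) that by (force simp: \<rho>_def)
      qed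
      \<comment> \<open>The open disc of radius 2 \<rho> about \<zeta>1 is free of contact points.
        The disc of radius \<rho> about the midpoint b is internally tangent to it at \<xi>, so its
        closure meets the contact set at \<xi> alone.\<close>
      define b where "b = (\<zeta>1 + \<xi>) / 2"
      have b\<xi>: "cmod (\<xi> - b) = \<rho>" and b1: "dist \<zeta>1 b = \<rho>"
      proof -
        have "\<xi> - b = (\<xi> - \<zeta>1) / 2" "\<zeta>1 - b = (\<zeta>1 - \<xi>) / 2" by (simp_all add: b_def field_simps)
        then show "cmod (\<xi> - b) = \<rho>" "dist \<zeta>1 b = \<rho>"
          unfolding dist_norm \<rho>_def by (simp_all only: norm_divide norm_minus_commute) auto
      qed
      have lt: "v x < C" if x: "x \<in> U" "x \<noteq> \<xi>" "cmod (x - b) \<le> \<rho>" for x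
      proof -
        have "x \<notin> A"
        proof (cases "dist \<zeta>1 x < 2 * \<rho>")
          case False
          have x1: "dist \<zeta>1 x = 2 * \<rho>" "cmod (x - b) = \<rho>"
            using False dist_triangle[of \<zeta>1 x b] b1 x(3) by (auto simp: dist_norm norm_minus_commute)
          \<comment> \<open>Equality in the triangle inequality: x lies on the ray from \<zeta>1
            through b, at the same distance as \<xi>.\<close>
          have "norm ((b - \<zeta>1) + (x - b)) = norm (b - \<zeta>1) + norm (x - b)"
            using x1 b1 by (simp add: dist_norm norm_minus_commute)
          then have "norm (b - \<zeta>1) *\<^sub>R (x - b) = norm (x - b) *\<^sub>R (b - \<zeta>1)"
            by (simp only: norm_triangle_eq)
          then have "x - b = b - \<zeta>1" using x1 b1 \<rho>0 by (simp add: dist_norm norm_minus_commute)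
          then have "x = \<xi>" by (simp add: b_def field_simps)
          then show ?thesis using x(2) by simp
        qed (rule away)
        then show ?thesis using le[OF x(1)] x(1) by (force simp: A_def v_def)
      qed
      have \<xi>U: "ball \<xi> \<rho> \<subseteq> U"
      proof
        fix x assume "x \<in> ball \<xi> \<rho>"
        then have "dist \<zeta>0 x < t + 2 * \<rho> + \<rho>"
          using dist_triangle[of \<zeta>0 x \<xi>] dist_triangle[of \<zeta>0 \<xi> \<zeta>1] \<zeta>1(1) by (simp add: \<rho>_def)
        then show "x \<in> U" using \<rho>t \<rho>0 t by (intro subsetD[OF t(3)]) simp
      qed
      have \<xi>A: "\<xi> \<in> A" using \<xi>(1) by (simp add: A'_def)
      define S where "S = sphere \<xi> (\<rho> / 2)"
      have SU: "S \<subseteq> U" using \<xi>U \<rho>0 by (auto simp: S_def)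
      have cS: "compact S" by (simp add: S_def)
      have "\<exists>\<beta>>0. \<forall>x\<in>S \<inter> cball b \<rho>. v x \<le> C - \<beta>"
      proof (cases "S \<inter> cball b \<rho> = {}")
        case False
        have "compact (S \<inter> cball b \<rho>)" using cS by (intro compact_Int_closed) auto
        moreover have "continuous_on (S \<inter> cball b \<rho>) v"
          by (rule continuous_on_subset[OF cv]) (use SU in auto)
        ultimately obtain x where x: "x \<in> S \<inter> cball b \<rho>" "\<forall>y\<in>S \<inter> cball b \<rho>. v y \<le> v x"
          using continuous_attains_sup[of "S \<inter> cball b \<rho>" v] False by blast
        have "v x < C"
          using x(1) SU \<rho>0 by (intro lt) (auto simp: S_def dist_norm norm_minus_commute)
        then show ?thesis using x(2) by (intro exI[of _ "C - v x"]) auto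
      qed (auto intro: exI[of _ 1])
      then obtain \<beta> where \<beta>: "\<beta> > 0" "\<And>x. x \<in> S \<Longrightarrow> x \<in> cball b \<rho> \<Longrightarrow> v x \<le> C - \<beta>" by blast
      \<comment> \<open>Hopf's barrier: \<open>h\<close> is harmonic, positive inside the tangent disc and negative outside.\<close>
      define h where "h \<zeta> = - of_real (\<beta> / 2) * Ln ((\<zeta> - b) / (\<xi> - b))" for \<zeta>
      have \<xi>b: "\<xi> - b \<noteq> 0" using b\<xi> \<rho>0 by auto
      have pos: "Re ((\<zeta> - b) / (\<xi> - b)) > 0" if "\<zeta> \<in> ball \<xi> \<rho>" for \<zeta>
      proof -
        have "(\<zeta> - b) / (\<xi> - b) - 1 = (\<zeta> - \<xi>) / (\<xi> - b)" using \<xi>b by (simp add: field_simps)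
        then have "cmod ((\<zeta> - b) / (\<xi> - b) - 1) < 1"
          using that \<rho>0 b\<xi> by (simp add: norm_divide dist_norm norm_minus_commute)
        then show ?thesis using abs_Re_le_cmod[of "(\<zeta> - b) / (\<xi> - b) - 1"] by simp
      qed
      have hh: "h holomorphic_on ball \<xi> \<rho>"
        unfolding h_def using pos \<xi>b
        by (intro holomorphic_intros) (auto simp: complex_nonpos_Reals_iff not_le)
      have Reh: "Re (h \<zeta>) = - (\<beta> / 2) * ln (cmod (\<zeta> - b) / \<rho>)" if "\<zeta> \<in> ball \<xi> \<rho>" for \<zeta>
      proof -
        have "(\<zeta> - b) / (\<xi> - b) \<noteq> 0" using pos[OF that] by auto
        then have "Re (Ln ((\<zeta> - b) / (\<xi> - b))) = ln (cmod ((\<zeta> - b) / (\<xi> - b)))" by (rule Re_Ln)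
        then show ?thesis unfolding h_def using b\<xi> by (simp add: norm_divide)
      qed
      have SB: "S \<subseteq> ball \<xi> \<rho>" using \<rho>0 by (auto simp: S_def)
      have ltC: "v x + Re (h x) < C" if x: "x \<in> S" for x
      proof (cases "x \<in> cball b \<rho>")
        case True
        \<comment> \<open>As S has radius \<rho>/2, it stays \<rho>/2 away from the pole b of the
          barrier, which is then at most (\<beta>/2) ln 2 and hence below the margin
          \<beta>.\<close>
        have "cmod (x - b) \<ge> \<rho> / 2"
          using x norm_triangle_ineq2[of "\<xi> - b" "\<xi> - x"] b\<xi> by (simp add: S_def dist_norm)
        then have "1/2 \<le> cmod (x - b) / \<rho>" using \<rho>0 by (simp add: field_simps)
        then have "ln (1/2) \<le> ln (cmod (x - b) / \<rho>)" by (intro ln_mono) auto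
        then have "- ln (cmod (x - b) / \<rho>) \<le> 1" using ln_2_less_1 by (simp add: ln_div)
        then have "\<beta> / 2 * (- ln (cmod (x - b) / \<rho>)) \<le> \<beta> / 2 * 1"
          using \<beta>(1) by (intro mult_left_mono) auto
        then have "Re (h x) \<le> \<beta> / 2" using Reh[of x] SB x by auto
        then show ?thesis using \<beta>(2)[OF x True] \<beta>(1) by linarith
      next
        case False
        then have "cmod (x - b) / \<rho> > 1" using \<rho>0 by (simp add: dist_norm norm_minus_commute)
        then have "ln (cmod (x - b) / \<rho>) > 0" by simp
        then have "Re (h x) < 0" using Reh[of x] SB x \<beta>(1) by (auto simp: mult_less_0_iff)
        moreover have "v x \<le> C" using le SU x by (auto simp: v_def)
        ultimately show ?thesis by simp
      qed
      have "\<xi> + of_real (\<rho> / 2) \<in> S" using \<rho>0 by (simp add: S_def dist_norm)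
      moreover have "continuous_on S (\<lambda>x. v x + Re (h x))"
        by (intro continuous_intros continuous_on_subset[OF cv SU]
            continuous_on_subset[OF holomorphic_on_imp_continuous_on[OF hh] SB])
      ultimately obtain x where x: "x \<in> S" "\<And>y. y \<in> S \<Longrightarrow> v y + Re (h y) \<le> v x + Re (h x)"
        using continuous_attains_sup[of S "\<lambda>x. v x + Re (h x)"] cS by blast
      have "\<phi> (f1 \<xi>, f2 \<xi>) + Re (g \<xi> + h \<xi>) \<le> v x + Re (h x)"
      proof (rule psh_max_principle[OF psh, where R = \<rho> and \<rho> = "\<rho> / 2" and g = "\<lambda>\<zeta>. g \<zeta> + h \<zeta>"])
        show "(\<lambda>\<zeta>. g \<zeta> + h \<zeta>) holomorphic_on ball \<xi> \<rho>"
          by (intro holomorphic_intros hh holomorphic_on_subset[OF hol(3) \<xi>U])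
        show "(f1 \<zeta>, f2 \<zeta>) \<in> V" if "\<zeta> \<in> cball \<xi> (\<rho> / 2)" for \<zeta>
          using that \<rho>0 by (intro fV subsetD[OF \<xi>U]) auto
        show "\<phi> (f1 \<zeta>, f2 \<zeta>) + Re (g \<zeta> + h \<zeta>) \<le> v x + Re (h x)" if "\<zeta> \<in> sphere \<xi> (\<rho> / 2)" for \<zeta>
          using x(2)[of \<zeta>] that by (simp add: S_def v_def)
      qed (use \<rho>0 in \<open>auto intro: holomorphic_on_subset[OF hol(1) \<xi>U] holomorphic_on_subset[OF hol(2) \<xi>U]\<close>)
      moreover have "Re (h \<xi>) = 0" using \<xi>b by (simp add: h_def)
      moreover have "v \<xi> = C" using \<xi>A by (simp add: A_def)
      ultimately show False using ltC[OF x(1)] by (simp add: v_def)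
    qed
    then show ?thesis using t(1) by blast
  qed
  then have "open A" unfolding open_contains_ball by blast
  then have "openin (top_of_set U) A" by (intro open_subset) (auto simp: A_def)
  with clo U(2) have "A = {} \<or> A = U" by (simp add: connected_clopen)
  moreover have "p \<in> A" using p by (simp add: A_def v_def)
  ultimately have "q \<in> A" using q by auto
  then show ?thesis by (simp add: A_def v_def)
qed

subsection \<open>The spiral enumerates the Gaussian integers\<close>

text \<open>Together with \<open>spiral_corner\<close>: the time and the position at which run j
  starts.\<close>

definition spiral_length :: "nat \<Rightarrow> nat" where
  "spiral_length j = (\<Sum>l<j. l div 2 + 1)"

definition spiral_corner :: "nat \<Rightarrow> complex" where
  "spiral_corner j = (\<Sum>l<j. of_nat (l div 2 + 1) * \<i> ^ l)"

lemma spiral_moves_Suc: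
  "spiral_moves (Suc j) = spiral_moves j @ replicate (j div 2 + 1) (\<i> ^ j)"
  by (simp add: spiral_moves_def)

lemma length_spiral_moves: "length (spiral_moves j) = spiral_length j"
  by (induction j) (simp_all add: spiral_moves_Suc spiral_length_def, simp add: spiral_moves_def)

lemma sum_list_spiral_moves: "sum_list (spiral_moves j) = spiral_corner j"
  by (induction j) (simp_all add: spiral_moves_Suc spiral_corner_def sum_list_replicate algebra_simps, simp add: spiral_moves_def)

lemma spiral_moves_mono: "j \<le> n \<Longrightarrow> \<exists>r. spiral_moves n = spiral_moves j @ r"
  by (induction n rule: dec_induct) (auto simp: spiral_moves_Suc)

lemma spiral_length_ge: "j \<le> spiral_length j"
  by (induction j) (auto simp: spiral_length_def)

lemma spiral_run:
  assumes "i \<le> j div 2 + 1"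
  shows "spiral (Suc (spiral_length j + i)) = spiral_corner j + of_nat i * \<i> ^ j"
proof (cases "i = 0")
  case True
  obtain r where "spiral_moves (Suc (spiral_length j + i)) = spiral_moves j @ r"
    using spiral_moves_mono[of j "Suc (spiral_length j + i)"] spiral_length_ge[of j] by auto
  then show ?thesis using True
    by (simp add: spiral_def length_spiral_moves sum_list_spiral_moves)
next
  case False
  obtain r where "spiral_moves (Suc (spiral_length j + i)) = spiral_moves (Suc j) @ r"
    using spiral_moves_mono[of "Suc j" "Suc (spiral_length j + i)"] spiral_length_ge[of j] by auto
  then have "spiral_moves (Suc (spiral_length j + i))
      = spiral_moves j @ replicate (j div 2 + 1) (\<i> ^ j) @ r"
    by (simp only: spiral_moves_Suc append_assoc)
  moreover have "take i (replicate (j div 2 + 1) (\<i> ^ j) @ r) = replicate i (\<i> ^ j)"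
    using assms by (simp del: replicate_Suc)
  ultimately have "take (spiral_length j + i) (spiral_moves (Suc (spiral_length j + i)))
      = spiral_moves j @ replicate i (\<i> ^ j)"
    by (simp only: take_append length_spiral_moves) (simp add: length_spiral_moves)
  then show ?thesis by (simp add: spiral_def sum_list_spiral_moves sum_list_replicate)
qed

lemma i_power_4_mult_add: "\<i> ^ (4 * k + j) = \<i> ^ j"
  by (simp add: power_add power_mult)

lemma spiral_length_Suc: "spiral_length (Suc j) = spiral_length j + (j div 2 + 1)"
  by (simp add: spiral_length_def)

lemma spiral_corner_Suc: "spiral_corner (Suc j) = spiral_corner j + of_nat (j div 2 + 1) * \<i> ^ j"
  by (simp add: spiral_corner_def)

lemma run_lengths:
  fixes k :: nat
  shows "(4 * k) div 2 = 2 * k" "(4 * k + 1) div 2 = 2 * k" "(4 * k + 2) div 2 = 2 * k + 1" "(4 * k + 3) div 2 = 2 * k + 1"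
  by auto

lemma four_mult_Suc:
  "4 * k + 1 = Suc (4 * k)" "4 * k + 2 = Suc (4 * k + 1)"
  "4 * k + 3 = Suc (4 * k + 2)" "4 * k + 4 = Suc (4 * k + 3)"
  by simp_all

lemma spiral_length_step:
  "spiral_length (4 * k + 1) = spiral_length (4 * k) + (2 * k + 1)"
  "spiral_length (4 * k + 2) = spiral_length (4 * k) + (4 * k + 2)"
  "spiral_length (4 * k + 3) = spiral_length (4 * k) + (6 * k + 4)"
  "spiral_length (4 * k + 4) = spiral_length (4 * k) + (8 * k + 6)"
proof -
  note e = four_mult_Suc[of k]
  note l = spiral_length_Suc[of "4 * k"] spiral_length_Suc[of "4 * k + 1"]
    spiral_length_Suc[of "4 * k + 2"] spiral_length_Suc[of "4 * k + 3"]
  note l = l[unfolded run_lengths, folded e]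
  show "spiral_length (4 * k + 1) = spiral_length (4 * k) + (2 * k + 1)"
    "spiral_length (4 * k + 2) = spiral_length (4 * k) + (4 * k + 2)"
    "spiral_length (4 * k + 3) = spiral_length (4 * k) + (6 * k + 4)"
    "spiral_length (4 * k + 4) = spiral_length (4 * k) + (8 * k + 6)"
    using l by linarith+
qed

lemma spiral_length_4: "spiral_length (4 * k) = 4 * k\<^sup>2 + 2 * k"
proof (induction k)
  case (Suc k)
  then show ?case using spiral_length_step(4)[of k]
    by (simp add: power2_eq_square algebra_simps)
qed (simp add: spiral_length_def)

lemma spiral_corner_step:
  "spiral_corner (4 * k + 1) = spiral_corner (4 * k) + (2 * of_nat k + 1)"
  "spiral_corner (4 * k + 2) = spiral_corner (4 * k) + (2 * of_nat k + 1) * (1 + \<i>)"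
  "spiral_corner (4 * k + 3) = spiral_corner (4 * k) - 1 + (2 * of_nat k + 1) * \<i>"
  "spiral_corner (4 * k + 4) = spiral_corner (4 * k) - 1 - \<i>"
proof -
  have p: "\<i> ^ (4 * k) = 1" "\<i> ^ (4 * k + 1) = \<i>" "\<i> ^ (4 * k + 2) = -1" "\<i> ^ (4 * k + 3) = -\<i>"
    using i_power_4_mult_add[of k 0] i_power_4_mult_add[of k 1] i_power_4_mult_add[of k 2]
      i_power_4_mult_add[of k 3] by (simp_all add: power3_eq_cube)
  note e = four_mult_Suc[of k]
  note l = spiral_corner_Suc[of "4 * k"] spiral_corner_Suc[of "4 * k + 1"]
    spiral_corner_Suc[of "4 * k + 2"] spiral_corner_Suc[of "4 * k + 3"]
  note l = l[unfolded run_lengths p, folded e]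
  show "spiral_corner (4 * k + 1) = spiral_corner (4 * k) + (2 * of_nat k + 1)"
    "spiral_corner (4 * k + 2) = spiral_corner (4 * k) + (2 * of_nat k + 1) * (1 + \<i>)"
    "spiral_corner (4 * k + 3) = spiral_corner (4 * k) - 1 + (2 * of_nat k + 1) * \<i>"
    "spiral_corner (4 * k + 4) = spiral_corner (4 * k) - 1 - \<i>"
    unfolding l by (simp_all add: algebra_simps)
qed

lemma spiral_corner_4: "spiral_corner (4 * k) = - of_nat k - \<i> * of_nat k"
proof (induction k)
  case (Suc k)
  have "4 * Suc k = 4 * k + 4" by simp
  then have "spiral_corner (4 * Suc k) = spiral_corner (4 * k) - 1 - \<i>"
    using spiral_corner_step(4)[of k] by (simp only:)
  also have "\<dots> = - of_nat (Suc k) - \<i> * of_nat (Suc k)"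
    unfolding Suc.IH by (simp add: algebra_simps)
  finally show ?case .
qed (simp add: spiral_corner_def)

text \<open>At the corner \<^term>\<open>spiral_corner (4 * k)\<close> the spiral has filled the square of radius
  \<^term>\<open>k\<close> except for its bottom row, of which only the left end has been visited.\<close>

definition spiral_block :: "nat \<Rightarrow> (int \<times> int) set" where
  "spiral_block k = insert (- int k, - int k) ({- int k..int k} \<times> {- int k + 1..int k})"

text \<open>The bound on n matters as much as the existence: there are exactly as many admissible n
  as points in the block, and injectivity will come from this count.\<close>

lemma spiral_covers_block:
  "(x, y) \<in> spiral_block k \<Longrightarrow>
    \<exists>n \<le> spiral_length (4 * k). spiral (Suc n) = of_int x + \<i> * of_int y"
proof (induction k arbitrary: x y)
  case 0
  then have "x = 0" "y = 0" by (auto simp: spiral_block_def)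
  then show ?case by (intro exI[of _ 0]) (auto simp: spiral_def)
next
  case (Suc k)
  have run: ?case if "i \<le> j div 2 + 1" "spiral_length j + i \<le> spiral_length (4 * k + 4)"
      "spiral_corner j + of_nat i * \<i> ^ j = of_int x + \<i> * of_int y" for i j
    using spiral_run[OF that(1)] that(2,3) by (auto simp: add.commute)
  have p: "\<i> ^ (4 * k) = 1" "\<i> ^ (4 * k + 1) = \<i>" "\<i> ^ (4 * k + 2) = -1" "\<i> ^ (4 * k + 3) = -\<i>"
    using i_power_4_mult_add[of k 0] i_power_4_mult_add[of k 1] i_power_4_mult_add[of k 2]
      i_power_4_mult_add[of k 3] by (simp_all add: power3_eq_cube)
  have "\<bar>x\<bar> \<le> int k + 1" "\<bar>y\<bar> \<le> int k + 1" using Suc.prems by (auto simp: spiral_block_def)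
  \<comment> \<open>The new block is the old one together with the points of the runs 4k, 4k+1,
    4k+2, 4k+3, which go right, up, left and down.\<close>
  then consider "(x, y) \<in> spiral_block k" | "y = - int k" "- int k \<le> x" "x \<le> int k + 1"
    | "x = int k + 1" "- int k \<le> y" "y \<le> int k + 1"
    | "y = int k + 1" "- int k - 1 \<le> x" "x \<le> int k + 1"
    | "x = - int k - 1" "- int k - 1 \<le> y" "y \<le> int k + 1"
    using Suc.prems unfolding spiral_block_def by auto linarith+
  then show ?case
  proof cases
    case 1
    obtain n where "n \<le> spiral_length (4 * k)" "spiral (Suc n) = of_int x + \<i> * of_int y"
      using Suc.IH[OF 1] by blast
    moreover have "spiral_length (4 * Suc k) = spiral_length (4 * k) + (8 * k + 6)"
      using spiral_length_step(4)[of k] by (simp add: add.commute)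
    ultimately show ?thesis by (intro exI[of _ n]) simp
  next
    case 2
    define i where "i = nat (x + int k)"
    have i: "of_nat i = (of_int x + of_nat k :: complex)" "i \<le> 2 * k + 1" using 2 by (auto simp: i_def)
    show ?thesis
      by (rule run[of i "4 * k"]) (use 2 i in \<open>simp_all add: spiral_length_step spiral_corner_4 p\<close>)
  next
    case 3
    define i where "i = nat (y + int k)"
    have i: "of_nat i = (of_int y + of_nat k :: complex)" "i \<le> 2 * k + 1" using 3 by (auto simp: i_def)
    show ?thesis
      by (rule run[of i "4 * k + 1"])
        (use 3 i in \<open>simp_all only: spiral_length_step spiral_corner_step spiral_corner_4 p run_lengths, simp_all add: algebra_simps\<close>)
  next
    case 4
    define i where "i = nat (int k + 1 - x)"
    have i: "of_nat i = (of_nat k + 1 - of_int x :: complex)" "i \<le> 2 * k + 2" using 4 by (auto simp: i_def)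
    show ?thesis
      by (rule run[of i "4 * k + 2"])
        (use 4 i in \<open>simp_all only: spiral_length_step spiral_corner_step spiral_corner_4 p run_lengths, simp_all add: algebra_simps\<close>)
  next
    case 5
    define i where "i = nat (int k + 1 - y)"
    have i: "of_nat i = (of_nat k + 1 - of_int y :: complex)" "i \<le> 2 * k + 2" using 5 by (auto simp: i_def)
    show ?thesis
      by (rule run[of i "4 * k + 3"])
        (use 5 i in \<open>simp_all only: spiral_length_step spiral_corner_step spiral_corner_4 p run_lengths, simp_all add: algebra_simps\<close>)
  qed
qed

section \<open>The spiral as a bijection onto the Gaussian integers, by counting\<close>

definition gaussian_ints :: "complex set" where
  "gaussian_ints = {z. Re z \<in> \<int> \<and> Im z \<in> \<int>}"

lemma card_spiral_block: "card (spiral_block k) = Suc (spiral_length (4 * k))"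
proof -
  have "card (spiral_block k) = Suc (nat (1 + 2 * int k) * nat (2 * int k))"
    by (simp add: spiral_block_def card_cartesian_product add.commute)
  also have "\<dots> = Suc ((1 + 2 * k) * (2 * k))" by (simp add: nat_add_distrib nat_mult_distrib)
  finally show ?thesis unfolding spiral_length_4 by (simp add: power2_eq_square algebra_simps)
qed

text \<open>Counting replaces a second look at the path: a map from the index range that covers a
  block of the same cardinality must be injective and hit nothing else.\<close>

lemma spiral_block_image:
  defines "N \<equiv> \<lambda>k. {..spiral_length (4 * k)}"
  shows "inj_on (\<lambda>n. spiral (Suc n)) (N k)" "(\<lambda>n. spiral (Suc n)) ` N k \<subseteq> gaussian_ints"
proof -
  let ?g = "\<lambda>(x, y). of_int x + \<i> * of_int y :: complex"
  have sub: "?g ` spiral_block k \<subseteq> (\<lambda>n. spiral (Suc n)) ` N k"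
    using spiral_covers_block unfolding N_def by (force simp: image_iff)
  have "inj_on ?g (spiral_block k)" by (auto simp: inj_on_def complex_eq_iff)
  then have c: "card (?g ` spiral_block k) = card (N k)"
    by (simp add: card_image card_spiral_block N_def)
  have fin: "finite (N k)" by (simp add: N_def)
  have le: "card ((\<lambda>n. spiral (Suc n)) ` N k) \<le> card (N k)" using fin by (rule card_image_le)
  then have eq: "?g ` spiral_block k = (\<lambda>n. spiral (Suc n)) ` N k"
    using fin sub c by (intro card_seteq) auto
  show "inj_on (\<lambda>n. spiral (Suc n)) (N k)" using c eq fin by (intro eq_card_imp_inj_on) auto
  show "(\<lambda>n. spiral (Suc n)) ` N k \<subseteq> gaussian_ints"
    unfolding eq[symmetric] by (auto simp: gaussian_ints_def)
qed

lemma bij_betw_spiral: "bij_betw (\<lambda>n. spiral (Suc n)) UNIV gaussian_ints"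
proof (rule bij_betw_imageI)
  have le: "n \<le> spiral_length (4 * n)" for n by (simp add: spiral_length_4)
  show "inj (\<lambda>n. spiral (Suc n))"
  proof (rule injI)
    fix m n assume eq: "spiral (Suc m) = spiral (Suc n)"
    have "m \<le> spiral_length (4 * max m n)" "n \<le> spiral_length (4 * max m n)"
      using le[of "max m n"] by auto
    then show "m = n" using inj_onD[OF spiral_block_image(1)[of "max m n"] eq] by simp
  qed
  show "range (\<lambda>n. spiral (Suc n)) = gaussian_ints"
  proof
    show "range (\<lambda>n. spiral (Suc n)) \<subseteq> gaussian_ints"
      using spiral_block_image(2) le by blast
    show "gaussian_ints \<subseteq> range (\<lambda>n. spiral (Suc n))"
    proof
      fix z assume "z \<in> gaussian_ints"
      then obtain x y where xy: "Re z = of_int x" "Im z = of_int y"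
        by (auto simp: gaussian_ints_def elim!: Ints_cases)
      have "(x, y) \<in> spiral_block (nat (\<bar>x\<bar> + \<bar>y\<bar> + 1))" by (auto simp: spiral_block_def)
      from spiral_covers_block[OF this] obtain n where "spiral (Suc n) = of_int x + \<i> * of_int y" by blast
      moreover have "z = of_int x + \<i> * of_int y" using xy by (simp add: complex_eq_iff)
      ultimately show "z \<in> range (\<lambda>n. spiral (Suc n))" by (metis rangeI)
    qed
  qed
qed

text \<open>Every move has modulus 1. The true growth is like a square root, but the weights can be
  chosen from a linear bound.\<close>

lemma norm_spiral_le: "cmod (spiral (Suc n)) \<le> real n"
proof -
  have *: "cmod (sum_list xs) \<le> real (length xs)" if "\<forall>x\<in>set xs. cmod x \<le> 1" for xs
    using that
  proof (induction xs)
    case (Cons x xs)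
    then show ?case using norm_triangle_ineq[of x "sum_list xs"] by simp
  qed simp
  have "\<forall>x\<in>set (take n (spiral_moves (Suc n))). cmod x \<le> 1"
  proof
    fix x assume "x \<in> set (take n (spiral_moves (Suc n)))"
    then have "x \<in> set (spiral_moves (Suc n))" by (rule in_set_takeD)
    then obtain j where "x = \<i> ^ j" by (auto simp: spiral_moves_def)
    then show "cmod x \<le> 1" by (simp add: norm_power)
  qed
  from *[OF this] show ?thesis by (simp add: spiral_def)
qed

subsection \<open>The limit set\<close>

text \<open>Rounding both coordinates leaves a distance of at most 1/sqrt 2. Open unit discs about
  lattice points thus cover the plane and can serve as chart domains.\<close>

lemma gaussian_int_near: "\<exists>a\<in>gaussian_ints. cmod (z - a) < 1"
proof
  define a where "a = Complex (of_int (round (Re z))) (of_int (round (Im z)))"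
  show "a \<in> gaussian_ints" by (simp add: a_def gaussian_ints_def)
  have "(Re (z - a))\<^sup>2 \<le> (1/2)\<^sup>2" "(Im (z - a))\<^sup>2 \<le> (1/2)\<^sup>2"
    using of_int_round_abs_le[of "Re z"] of_int_round_abs_le[of "Im z"]
    unfolding abs_le_square_iff[symmetric] by (simp_all add: a_def abs_minus_commute)
  then have "(cmod (z - a))\<^sup>2 < 1\<^sup>2" unfolding cmod_power2 by (simp add: power2_eq_square)
  then show "cmod (z - a) < 1" by (rule power2_less_imp_less) simp
qed

text \<open>Some coordinate difference is a nonzero integer. An open unit disc about a lattice point
  therefore contains no second branch point.\<close>

lemma gaussian_int_dist:
  assumes "a \<in> gaussian_ints" "b \<in> gaussian_ints" "a \<noteq> b"
  shows "1 \<le> cmod (a - b)"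
proof -
  have "Re a \<noteq> Re b \<or> Im a \<noteq> Im b" using assms(3) complex_eq_iff by blast
  moreover have "Re a - Re b \<in> \<int>" "Im a - Im b \<in> \<int>" using assms by (auto simp: gaussian_ints_def)
  ultimately have "1 \<le> \<bar>Re (a - b)\<bar> \<or> 1 \<le> \<bar>Im (a - b)\<bar>"
    using Ints_nonzero_abs_ge1[of "Re a - Re b"] Ints_nonzero_abs_ge1[of "Im a - Im b"] by auto
  then show ?thesis using abs_Re_le_cmod[of "a - b"] abs_Im_le_cmod[of "a - b"] by linarith
qed

text \<open>The l1 norm, because it drops by exactly one under a suitable unit step towards a
  lattice point; this drives the inductions along lattice paths.\<close>

definition taxicab :: "complex \<Rightarrow> real" where
  "taxicab z = \<bar>Re z\<bar> + \<bar>Im z\<bar>"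

lemma taxicab_le_0: "taxicab (a - b) \<le> 0 \<Longrightarrow> a = b"
  unfolding taxicab_def complex_eq_iff minus_complex.sel by linarith

lemma Ints_step_towards:
  fixes x y :: real
  assumes "x \<in> \<int>" "y \<in> \<int>" "x \<noteq> y"
  shows "\<exists>x'\<in>\<int>. \<bar>x' - x\<bar> = 1 \<and> \<bar>x' - y\<bar> = \<bar>x - y\<bar> - 1"
proof (rule bexI[of _ "x + sgn (y - x)"])
  have "1 \<le> \<bar>x - y\<bar>" using assms by (intro Ints_nonzero_abs_ge1) auto
  then show "\<bar>x + sgn (y - x) - x\<bar> = 1 \<and> \<bar>x + sgn (y - x) - y\<bar> = \<bar>x - y\<bar> - 1"
    by (auto simp: sgn_if)
  show "x + sgn (y - x) \<in> \<int>" using assms by (auto simp: sgn_if)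
qed

lemma gaussian_int_step_towards:
  assumes "a \<in> gaussian_ints" "b \<in> gaussian_ints" "a \<noteq> b"
  shows "\<exists>c\<in>gaussian_ints. cmod (c - a) = 1 \<and> taxicab (c - b) = taxicab (a - b) - 1"
proof (cases "Re a = Re b")
  case True
  then have "Im a \<noteq> Im b" using assms(3) complex_eq_iff by blast
  then obtain y where "y \<in> \<int>" "\<bar>y - Im a\<bar> = 1" "\<bar>y - Im b\<bar> = \<bar>Im a - Im b\<bar> - 1"
    using Ints_step_towards[of "Im a" "Im b"] assms by (auto simp: gaussian_ints_def)
  then show ?thesis using assms True
    by (intro bexI[of _ "Complex (Re a) y"]) (auto simp: gaussian_ints_def taxicab_def cmod_def)
next
  case False
  then obtain x where "x \<in> \<int>" "\<bar>x - Re a\<bar> = 1" "\<bar>x - Re b\<bar> = \<bar>Re a - Re b\<bar> - 1"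
    using Ints_step_towards[of "Re a" "Re b"] assms by (auto simp: gaussian_ints_def)
  then show ?thesis using assms
    by (intro bexI[of _ "Complex x (Im a)"]) (auto simp: gaussian_ints_def taxicab_def cmod_def)
qed

lemma norm_fst: "norm (fst p) \<le> norm p"
  by (metis norm_fst_le prod.collapse)

section \<open>Sequences of roots and their weighted sums\<close>

text \<open>The spiral is represented by its bijectivity and by the size of \<open>A k\<close>,
  which the last assumption couples to the weights: a root over |z| \<le> B is at most (1 + B)(1 +
  |A k|), so the k-th term is at most (1 + B) 2^(-k).\<close>

locale wermer_data =
  fixes A :: "nat \<Rightarrow> complex" and e :: "nat \<Rightarrow> real"
  assumes bij: "bij_betw A UNIV gaussian_ints"
    and e_pos: "0 < e k"
    and e_le: "e k * (1 + cmod (A k)) \<le> (1/2) ^ k"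
begin

text \<open>\<open>X\<close> is the limit set, written as an infinite sum of square roots; indices are shifted by one
  against \<^const>\<open>wermer_E\<close>.\<close>

definition roots :: "complex \<Rightarrow> (nat \<Rightarrow> complex) set" where
  "roots z = {s. \<forall>k. (s k)\<^sup>2 = z - A k}"

definition val :: "(nat \<Rightarrow> complex) \<Rightarrow> complex" where
  "val s = (\<Sum>k. of_real (e k) * s k)"

definition X :: "(complex \<times> complex) set" where
  "X = {(z, val s) |z s. s \<in> roots z}"

definition trunc :: "nat \<Rightarrow> (complex \<times> complex) set" where
  "trunc n = {(z, w). \<exists>s. (\<forall>k<n. (s k)\<^sup>2 = z - A k) \<and> w = (\<Sum>k<n. of_real (e k) * s k)}"

lemma A_mem: "A k \<in> gaussian_ints"
  using bij bij_betwE by blast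

lemma A_surj: "a \<in> gaussian_ints \<Longrightarrow> \<exists>k. A k = a"
  using bij unfolding bij_betw_def by (metis imageE)

lemma A_inj: "A j = A k \<longleftrightarrow> j = k"
  using bij unfolding bij_betw_def inj_on_def by blast

lemma A_near: "\<exists>m. cmod (z - A m) < 1"
  using gaussian_int_near A_surj by metis

lemma rootsD: "s \<in> roots z \<Longrightarrow> (s k)\<^sup>2 = z - A k"
  by (simp add: roots_def)

lemma roots_csqrt: "(\<lambda>k. csqrt (z - A k)) \<in> roots z"
  by (simp add: roots_def)

text \<open>Uses t \<le> 1 + t^2 for t = |s|. The product form separates z from k, to match the
  decay of the weights.\<close>

lemma norm_root_le:
  assumes "(s::complex)\<^sup>2 = z - A k" "cmod z \<le> B"
  shows "cmod s \<le> (1 + B) * (1 + cmod (A k))"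
proof -
  have B: "0 \<le> B" using assms(2) norm_ge_zero order_trans by blast
  have "0 \<le> (cmod s - 1)\<^sup>2 + cmod s" by simp
  then have "cmod s \<le> 1 + (cmod s)\<^sup>2" by (simp add: power2_eq_square algebra_simps)
  also have "(cmod s)\<^sup>2 = cmod (z - A k)" using assms(1) by (metis norm_power)
  also have "\<dots> \<le> B + cmod (A k)" using norm_triangle_ineq4[of z "A k"] assms(2) by linarith
  also have "1 + (B + cmod (A k)) \<le> (1 + B) * (1 + cmod (A k))" using B by (simp add: algebra_simps)
  finally show ?thesis by simp
qed

lemma norm_term_le:
  assumes "(s::complex)\<^sup>2 = z - A k" "cmod z \<le> B"
  shows "cmod (of_real (e k) * s) \<le> (1 + B) * (1/2) ^ k"
proof -
  have B: "0 \<le> B" using assms(2) norm_ge_zero order_trans by blast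
  have "cmod (of_real (e k) * s) = e k * cmod s" using e_pos[of k] by (simp add: norm_mult)
  also have "\<dots> \<le> e k * ((1 + B) * (1 + cmod (A k)))"
    using norm_root_le[OF assms] e_pos[of k] by (intro mult_left_mono) auto
  also have "\<dots> = (1 + B) * (e k * (1 + cmod (A k)))" by simp
  also have "\<dots> \<le> (1 + B) * (1/2) ^ k" using e_le[of k] B by (intro mult_left_mono) auto
  finally show ?thesis .
qed

lemma summable_bound: "summable (\<lambda>k. (1 + B) * (1/2::real) ^ k)"
  by (intro summable_mult summable_geometric) auto

lemma val_tail:
  assumes "s \<in> roots z" "cmod z \<le> B"
  shows "cmod (val s - (\<Sum>k<n. of_real (e k) * s k)) \<le> 2 * (1 + B) * (1/2) ^ n"
proof -
  have sm: "summable (\<lambda>k. of_real (e k) * s k)"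
    by (rule summable_comparison_test'[OF summable_bound[of B], of 0]) 
       (use norm_term_le[OF rootsD[OF assms(1)] assms(2)] in auto)
  have sm2: "summable (\<lambda>k. (1 + B) * (1/2::real) ^ (k + n))"
    using summable_bound[of B] by (subst summable_iff_shift)
  have "val s - (\<Sum>k<n. of_real (e k) * s k) = (\<Sum>k. of_real (e (k + n)) * s (k + n))"
    unfolding val_def by (rule suminf_minus_initial_segment[OF sm, symmetric])
  also have "cmod \<dots> \<le> (\<Sum>k. (1 + B) * (1/2::real) ^ (k + n))"
    by (intro norm_suminf_le sm2 norm_term_le[OF rootsD[OF assms(1)] assms(2)])
  also have "\<dots> = (\<Sum>k. ((1 + B) * (1/2) ^ n) * (1/2) ^ k)" by (simp add: power_add mult_ac)
  also have "\<dots> = ((1 + B) * (1/2) ^ n) * (\<Sum>k. (1/2) ^ k)"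
    by (intro suminf_mult summable_geometric) auto
  also have "(\<Sum>k. (1/2::real) ^ k) = 2" by (subst suminf_geometric) auto
  finally show ?thesis by (simp add: algebra_simps)
qed

lemma val_close:
  assumes "s \<in> roots z" "t \<in> roots z" "cmod z \<le> B" "\<And>k. k < n \<Longrightarrow> s k = t k"
  shows "cmod (val s - val t) \<le> 4 * (1 + B) * (1/2) ^ n"
proof -
  have "(\<Sum>k<n. of_real (e k) * s k) = (\<Sum>k<n. of_real (e k) * t k)"
    using assms(4) by (intro sum.cong) auto
  then show ?thesis
    using val_tail[OF assms(1,3), of n] val_tail[OF assms(2,3), of n]
      norm_triangle_ineq4[of "val s - (\<Sum>k<n. of_real (e k) * s k)" "val t - (\<Sum>k<n. of_real (e k) * t k)"]
    by (simp add: algebra_simps)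
qed

lemma bound_tendsto_0: "(\<lambda>n. C * (1/2::real) ^ n) \<longlonglongrightarrow> 0"
  using tendsto_mult_left[OF LIMSEQ_power_zero[of "1/2::real"], of C] by simp

section \<open>Compactness over discs, closedness and convergence\<close>

text \<open>Tychonoff: the root sequences over |z| \<le> B form a closed subset of a product of
  discs, and \<open>val\<close> is continuous there as a uniform limit of finite sums. The base
  point is recovered from s as (s 0)^2 + A 0, so the set is the image under a map of s
  alone.\<close>

lemma compact_X_part:
  fixes B :: real
  shows "compact {p \<in> X. cmod (fst p) \<le> B}"
proof -
  define r where "r k = (1 + B) * (1 + cmod (A k))" for k
  define K where "K = PiE UNIV (\<lambda>k. cball 0 (r k)) \<inter>
     {s. (\<forall>k. (s k)\<^sup>2 = (s 0)\<^sup>2 + A 0 - A k) \<and> cmod ((s 0)\<^sup>2 + A 0) \<le> B}"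
  define pt where "pt s = ((s 0)\<^sup>2 + A 0, val s)" for s
  have K_iff: "s \<in> K \<longleftrightarrow> s \<in> roots ((s 0)\<^sup>2 + A 0) \<and> cmod ((s 0)\<^sup>2 + A 0) \<le> B" for s
  proof
    assume s: "s \<in> roots ((s 0)\<^sup>2 + A 0) \<and> cmod ((s 0)\<^sup>2 + A 0) \<le> B"
    then have "s k \<in> cball 0 (r k)" for k
      using norm_root_le[OF rootsD, of s "(s 0)\<^sup>2 + A 0" B k] by (simp add: r_def)
    then have "s \<in> PiE UNIV (\<lambda>k. cball 0 (r k))" by (simp add: PiE_UNIV_domain)
    then show "s \<in> K" using s unfolding K_def roots_def by blast
  next
    assume "s \<in> K"
    then show "s \<in> roots ((s 0)\<^sup>2 + A 0) \<and> cmod ((s 0)\<^sup>2 + A 0) \<le> B"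
      unfolding K_def roots_def by blast
  qed
  have "{p \<in> X. cmod (fst p) \<le> B} = pt ` K"
  proof (intro equalityI subsetI)
    fix p assume p: "p \<in> {p \<in> X. cmod (fst p) \<le> B}"
    then obtain z s where s: "p = (z, val s)" "s \<in> roots z" by (auto simp: X_def)
    then have "(s 0)\<^sup>2 + A 0 = z" by (simp add: rootsD)
    then show "p \<in> pt ` K" using p s by (auto simp: K_iff pt_def)
  qed (auto simp: K_iff pt_def X_def)
  moreover have "compact (pt ` K)"
  proof (rule compact_continuous_image)
    have c [continuous_intros]: "continuous_on S (\<lambda>s. s k :: complex)" for S and k :: nat
      by (rule continuous_on_subset[OF continuous_on_product_coordinates]) simp
    have "closed {s :: nat \<Rightarrow> complex. (\<forall>k. (s k)\<^sup>2 = (s 0)\<^sup>2 + A 0 - A k) \<and> cmod ((s 0)\<^sup>2 + A 0) \<le> B}"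
      by (intro closed_Collect_conj closed_Collect_all closed_Collect_eq closed_Collect_le continuous_intros)
    moreover have "compact (PiE UNIV (\<lambda>k. cball (0::complex) (r k)))"
      using compactin_PiE[of "\<lambda>k::nat. euclidean :: complex topology" UNIV "\<lambda>k. cball 0 (r k)"]
      by (simp add: euclidean_product_topology)
    ultimately show "compact K" unfolding K_def by (rule compact_Int_closed[rotated])
    have "uniform_limit K (\<lambda>n s. \<Sum>k<n. of_real (e k) * s k) (\<lambda>s. \<Sum>k. of_real (e k) * s k) sequentially"
    proof (rule Weierstrass_m_test[where M = "\<lambda>k. (1 + B) * (1/2) ^ k"])
      show "cmod (of_real (e k) * s k) \<le> (1 + B) * (1/2) ^ k" if "s \<in> K" for k s
        using that norm_term_le[OF rootsD] by (auto simp: K_iff)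
    qed (rule summable_bound)
    then have "continuous_on K val"
      unfolding val_def by (rule uniform_limit_theorem[rotated]) (auto intro!: continuous_intros always_eventually)
    then show "continuous_on K pt"
      unfolding pt_def by (intro continuous_intros)
  qed
  ultimately show ?thesis by simp
qed

lemma closed_X: "closed X"
  unfolding closed_sequential_limits
proof (intro allI impI, elim conjE)
  fix p l assume p: "\<forall>n. p n \<in> X" "p \<longlonglongrightarrow> l"
  have "bounded (range p)" using p(2) by (intro convergent_imp_bounded) (auto simp: convergent_def)
  then obtain B where B: "\<And>n. norm (p n) \<le> B" by (auto simp: bounded_iff)
  have "\<forall>n. p n \<in> {p \<in> X. cmod (fst p) \<le> B}"
  proof
    fix n show "p n \<in> {p \<in> X. cmod (fst p) \<le> B}"
      using B[of n] norm_fst[of "p n"] p(1) by auto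
  qed
  then have "l \<in> {p \<in> X. cmod (fst p) \<le> B}"
    using compact_imp_closed[OF compact_X_part[of B]] p(2) by (meson closed_sequentially)
  then show "l \<in> X" by simp
qed

lemma X_near_trunc:
  assumes "x \<in> trunc n" "cmod (fst x) \<le> B"
  shows "\<exists>y\<in>X. dist x y \<le> 2 * (1 + B) * (1/2) ^ n"
proof -
  obtain z w s where x: "x = (z, w)" "\<And>k. k < n \<Longrightarrow> (s k)\<^sup>2 = z - A k" "w = (\<Sum>k<n. of_real (e k) * s k)"
    using assms(1) unfolding trunc_def by blast
  \<comment> \<open>Any continuation of the finite choice of roots will do: the tail is small
    whatever its signs.\<close>
  define t where "t k = (if k < n then s k else csqrt (z - A k))" for k
  have t: "t \<in> roots z" using x(2) by (auto simp: t_def roots_def)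
  have "w = (\<Sum>k<n. of_real (e k) * t k)" unfolding x(3) by (intro sum.cong) (auto simp: t_def)
  then have "dist x (z, val t) \<le> 2 * (1 + B) * (1/2) ^ n"
    using val_tail[OF t, of B n] assms(2) x(1) by (simp add: dist_Pair_Pair dist_norm norm_minus_commute)
  then show ?thesis using t by (auto simp: X_def)
qed

lemma trunc_near_X:
  assumes "s \<in> roots z" "cmod z \<le> B"
  shows "(z, \<Sum>k<n. of_real (e k) * s k) \<in> trunc n"
    "dist (z, \<Sum>k<n. of_real (e k) * s k) (z, val s) \<le> 2 * (1 + B) * (1/2) ^ n"
  using assms val_tail[OF assms, of n]
  by (auto simp: trunc_def roots_def dist_Pair_Pair dist_norm norm_minus_commute)

lemma wermer_limit_eq_X:
  assumes "\<And>n. 1 \<le> n \<Longrightarrow> E n = trunc n"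
  shows "wermer_limit E = X"
proof (intro equalityI subsetI)
  fix b assume "b \<in> X"
  then obtain z s where b: "b = (z, val s)" "s \<in> roots z" by (auto simp: X_def)
  define bs where "bs n = (z, \<Sum>k<n. of_real (e k) * s k)" for n
  have "(\<lambda>n. dist (bs n) b) \<longlonglongrightarrow> 0"
    using bound_tendsto_0[of "2 * (1 + cmod z)"]
    by (rule tendsto_sandwich[OF _ _ tendsto_const, rotated 2])
       (use trunc_near_X(2)[OF b(2), of "cmod z"] b(1) in \<open>auto simp: bs_def\<close>)
  then have "bs \<longlonglongrightarrow> b" by (simp add: tendsto_dist_iff[symmetric])
  moreover have "\<forall>n\<ge>1. bs n \<in> E n"
    using trunc_near_X(1)[OF b(2) order_refl] assms by (auto simp: bs_def)
  ultimately show "b \<in> wermer_limit E" by (auto simp: wermer_limit_def)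
next
  fix b assume "b \<in> wermer_limit E"
  then obtain bs where bs: "\<And>n. n \<ge> 1 \<Longrightarrow> bs n \<in> trunc n" "bs \<longlonglongrightarrow> b"
    using assms by (auto simp: wermer_limit_def)
  have "bounded (range bs)" using bs(2) by (intro convergent_imp_bounded) (auto simp: convergent_def)
  then obtain B where B: "\<And>n. norm (bs n) \<le> B" by (auto simp: bounded_iff)
  have "cmod (fst (bs n)) \<le> B" for n
    using B[of n] norm_fst[of "bs n"] by linarith
  then have "\<forall>n. n \<ge> 1 \<longrightarrow> (\<exists>y\<in>X. dist (bs n) y \<le> 2 * (1 + B) * (1/2) ^ n)"
    using X_near_trunc bs(1) by blast
  then obtain y where y: "\<And>n. n \<ge> 1 \<Longrightarrow> y n \<in> X \<and> dist (bs n) (y n) \<le> 2 * (1 + B) * (1/2) ^ n"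
    by metis
  have "(\<lambda>n. dist (bs n) (y n)) \<longlonglongrightarrow> 0"
    by (rule tendsto_sandwich[OF _ _ tendsto_const bound_tendsto_0[of "2 * (1 + B)"]])
       (use y in \<open>auto simp: eventually_at_top_linorder intro!: exI[of _ 1]\<close>)
  then have "y \<longlonglongrightarrow> b"
    using tendsto_diff[OF bs(2) tendsto_norm_zero_cancel, of "\<lambda>n. bs n - y n"] by (simp add: dist_norm)
  \<comment> \<open>y is controlled only from index 1 on, hence the shift before closedness is
    applied.\<close>
  then have "(\<lambda>n. y (Suc n)) \<longlonglongrightarrow> b" by (rule LIMSEQ_Suc)
  moreover have "\<forall>n. y (Suc n) \<in> X" using y by auto
  ultimately show "b \<in> X" using closed_X closed_sequentially by metis
qed

text \<open>Matched points lie over the same z and differ in w by a tail of the series, which is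
  uniformly small over |z| \<le> B.\<close>

lemma local_hausdorff_tendsto_X:
  assumes "\<And>n. 1 \<le> n \<Longrightarrow> E n = trunc n"
  shows "local_hausdorff_tendsto E X"
  unfolding local_hausdorff_tendsto_def
proof (intro allI impI)
  fix K :: "(complex \<times> complex) set" and \<epsilon> :: real
  assume "compact K" and \<epsilon>: "0 < \<epsilon>"
  then obtain B where B: "\<And>x. x \<in> K \<Longrightarrow> norm x \<le> B" using compact_imp_bounded bounded_iff by metis
  have B': "cmod (fst x) \<le> B" if "x \<in> K" for x
    using B[OF that] norm_fst[of x] by linarith
  have "\<forall>\<^sub>F n in sequentially. 2 * (1 + B) * (1/2::real) ^ n < \<epsilon>"
    using bound_tendsto_0 \<epsilon> by (rule order_tendstoD)
  with eventually_ge_at_top[of 1]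
  show "\<forall>\<^sub>F n in sequentially. (\<forall>x\<in>E n \<inter> K. \<exists>y\<in>X. dist x y < \<epsilon>) \<and> (\<forall>y\<in>X \<inter> K. \<exists>x\<in>E n. dist x y < \<epsilon>)"
  proof eventually_elim
    case (elim n)
    show ?case
    proof (intro conjI ballI)
      fix x assume "x \<in> E n \<inter> K"
      then have "x \<in> trunc n" "cmod (fst x) \<le> B" using B' assms[OF elim(1)] by auto
      then obtain y where "y \<in> X" "dist x y \<le> 2 * (1 + B) * (1/2) ^ n" using X_near_trunc by blast
      then show "\<exists>y\<in>X. dist x y < \<epsilon>" using elim(2) by (intro bexI[of _ y]) linarith+
    next
      fix y assume y: "y \<in> X \<inter> K"
      then obtain z s where zs: "y = (z, val s)" "s \<in> roots z" by (auto simp: X_def)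
      then have "cmod z \<le> B" using B'[of y] y by simp
      from trunc_near_X[OF zs(2) this, of n] show "\<exists>x\<in>E n. dist x y < \<epsilon>"
        using zs(1) assms[OF elim(1)] elim(2)
        by (intro bexI[of _ "(z, \<Sum>k<n. of_real (e k) * s k)"]) auto
    qed
  qed
qed

lemma X_over: "\<exists>p\<in>X. fst p = z"
  using roots_csqrt[of z] by (force simp: X_def)

lemma X_nonempty: "X \<noteq> {}"
  using X_over by blast

lemma X_unbounded: "\<not> bounded X"
proof
  assume "bounded X"
  then obtain B where B: "\<And>p. p \<in> X \<Longrightarrow> norm p \<le> B" by (auto simp: bounded_iff)
  obtain p where "p \<in> X" "fst p = of_real (\<bar>B\<bar> + 1)" using X_over by blast
  then show False using B[of p] norm_fst[of p] by (simp add: norm_of_real del: of_real_add)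
qed

subsection \<open>Leaves\<close>

text \<open>Over the unit disc about \<open>A m\<close> every root except the \<open>m\<close>-th is single valued, so
  \<open>\<zeta> = sqrt (z - A m)\<close> is a uniformising parameter for a leaf of \<open>X\<close>.\<close>

definition branch :: "nat \<Rightarrow> nat \<Rightarrow> complex \<Rightarrow> complex" where
  "branch m k z = csqrt (A m - A k) * csqrt ((z - A k) / (A m - A k))"

definition chart :: "nat \<Rightarrow> (nat \<Rightarrow> complex) \<Rightarrow> complex \<Rightarrow> nat \<Rightarrow> complex" where
  "chart m \<sigma> \<zeta> k = (if k = m then \<zeta> else \<sigma> k * branch m k (A m + \<zeta>\<^sup>2))"

definition signs :: "(nat \<Rightarrow> complex) set" where
  "signs = {\<sigma>. \<forall>k. (\<sigma> k)\<^sup>2 = 1}"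

definition flip :: "nat \<Rightarrow> (nat \<Rightarrow> complex) \<Rightarrow> nat \<Rightarrow> complex" where
  "flip j s = s(j := - s j)"

text \<open>Says that the root sequences satisfying P form a union of leaves. Predicates on root
  sequences, rather than sets of points of \<open>X\<close>, avoid deciding whether
  \<open>val\<close> separates the sequences over a given z.\<close>

definition leaf_invariant :: "((nat \<Rightarrow> complex) \<Rightarrow> bool) \<Rightarrow> bool" where
  "leaf_invariant P \<longleftrightarrow> (\<forall>m. \<forall>\<sigma>\<in>signs. \<forall>\<zeta>\<in>ball 0 1. \<forall>\<zeta>'\<in>ball 0 1.
     P (chart m \<sigma> \<zeta>) \<longrightarrow> P (chart m \<sigma> \<zeta>'))"

lemma branch_square: "k \<noteq> m \<Longrightarrow> (branch m k z)\<^sup>2 = z - A k"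
  using A_inj[of m k] by (simp add: branch_def power_mult_distrib)

text \<open>Dividing by the value at the centre brings the quotient within distance 1 of the number
  1, away from the cut of \<open>csqrt\<close>; this is why \<open>branch\<close> is normalised at
  \<open>A m\<close>.\<close>

lemma Re_quotient_pos:
  assumes "k \<noteq> m" "cmod (z - A m) < 1"
  shows "Re ((z - A k) / (A m - A k)) > 0"
proof -
  have ne: "A m - A k \<noteq> 0" using A_inj[of m k] assms by simp
  have "1 \<le> cmod (A m - A k)" using gaussian_int_dist[OF A_mem A_mem] ne by simp
  then have "cmod ((z - A m) / (A m - A k)) < 1"
    using assms(2) by (simp add: norm_divide divide_less_eq_1)
  moreover have "(z - A k) / (A m - A k) = 1 + (z - A m) / (A m - A k)" using ne by (simp add: field_simps)
  ultimately show ?thesis using abs_Re_le_cmod[of "(z - A m) / (A m - A k)"] by simp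
qed

lemma branch_holomorphic: "k \<noteq> m \<Longrightarrow> branch m k holomorphic_on ball (A m) 1"
  unfolding branch_def using A_inj[of m k] Re_quotient_pos[of k m]
  by (intro holomorphic_intros)
     (auto simp: complex_nonpos_Reals_iff not_le dist_norm norm_minus_commute)

lemma chart_square_in_ball: "\<zeta> \<in> ball 0 1 \<Longrightarrow> A m + \<zeta>\<^sup>2 \<in> ball (A m) 1"
  by (simp add: dist_norm norm_power power_less_one_iff)

lemma chart_roots: "\<sigma> \<in> signs \<Longrightarrow> chart m \<sigma> \<zeta> \<in> roots (A m + \<zeta>\<^sup>2)"
  by (auto simp: chart_def signs_def roots_def power_mult_distrib branch_square)

lemma chart_surj:
  assumes s: "s \<in> roots z" and z: "cmod (z - A m) < 1"
  shows "\<exists>\<sigma>\<in>signs. s = chart m \<sigma> (s m)" "s m \<in> ball 0 1" "z = A m + (s m)\<^sup>2"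
proof -
  show zm: "z = A m + (s m)\<^sup>2" using rootsD[OF s, of m] by simp
  then have "(cmod (s m))\<^sup>2 < 1\<^sup>2" using z by (simp add: norm_power)
  then have "cmod (s m) < 1" by (rule power2_less_imp_less) simp
  then show "s m \<in> ball 0 1" by simp
  \<comment> \<open>Default 1 at k = m, where the root is the coordinate itself; it keeps \<sigma>
    in \<open>signs\<close>.\<close>
  define \<sigma> where "\<sigma> k = (if k = m then 1 else s k / branch m k z)" for k
  have nz: "branch m k z \<noteq> 0" if "k \<noteq> m" for k
  proof
    assume "branch m k z = 0"
    then have "z - A k = 0" using branch_square[OF that, of z] by simp
    then show False using Re_quotient_pos[OF that z] by simp
  qed
  have "(\<sigma> k)\<^sup>2 = 1" for k
  proof (cases "k = m")
    case False
    then have "(\<sigma> k)\<^sup>2 = (branch m k z)\<^sup>2 / (branch m k z)\<^sup>2"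
      by (simp only: \<sigma>_def power_divide rootsD[OF s] branch_square[OF False] if_False)
    then show ?thesis using nz[OF False] by simp
  qed (simp add: \<sigma>_def)
  then have "\<sigma> \<in> signs" by (simp add: signs_def)
  moreover have "s = chart m \<sigma> (s m)"
    using nz unfolding fun_eq_iff chart_def zm[symmetric] by (simp add: \<sigma>_def)
  ultimately show "\<exists>\<sigma>\<in>signs. s = chart m \<sigma> (s m)" by blast
qed

lemma val_chart_holomorphic:
  assumes "\<sigma> \<in> signs"
  shows "(\<lambda>\<zeta>. val (chart m \<sigma> \<zeta>)) holomorphic_on ball 0 1"
proof (rule holomorphic_uniform_sequence)
  show "(\<lambda>\<zeta>. \<Sum>k<n. of_real (e k) * chart m \<sigma> \<zeta> k) holomorphic_on ball 0 1" for n
  proof (intro holomorphic_intros)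
    fix k
    show "(\<lambda>\<zeta>. chart m \<sigma> \<zeta> k) holomorphic_on ball 0 1"
    proof (cases "k = m")
      case False
      have "(\<lambda>\<zeta>. A m + \<zeta>\<^sup>2) ` ball 0 1 \<subseteq> ball (A m) 1" using chart_square_in_ball by blast
      from holomorphic_on_compose_gen[OF _ branch_holomorphic[OF False] this]
      have "(\<lambda>\<zeta>. branch m k (A m + \<zeta>\<^sup>2)) holomorphic_on ball 0 1"
        by (simp add: o_def holomorphic_intros)
      then show ?thesis using False by (simp add: chart_def holomorphic_intros)
    qed (simp add: chart_def)
  qed
  have "uniform_limit (ball 0 1) (\<lambda>n \<zeta>. \<Sum>k<n. of_real (e k) * chart m \<sigma> \<zeta> k)
      (\<lambda>\<zeta>. \<Sum>k. of_real (e k) * chart m \<sigma> \<zeta> k) sequentially"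
  proof (rule Weierstrass_m_test[where M = "\<lambda>k. (1 + (cmod (A m) + 1)) * (1/2) ^ k"])
    fix k and \<zeta> :: complex assume "\<zeta> \<in> ball 0 1"
    then have "cmod (A m + \<zeta>\<^sup>2) \<le> cmod (A m) + 1"
      using norm_triangle_ineq[of "A m" "\<zeta>\<^sup>2"] power_le_one[of "cmod \<zeta>" 2] by (simp add: norm_power)
    then show "cmod (of_real (e k) * chart m \<sigma> \<zeta> k) \<le> (1 + (cmod (A m) + 1)) * (1/2) ^ k"
      by (rule norm_term_le[OF rootsD[OF chart_roots[OF assms]]])
  qed (rule summable_bound)
  then have ul: "uniform_limit (ball 0 1) (\<lambda>n \<zeta>. \<Sum>k<n. of_real (e k) * chart m \<sigma> \<zeta> k)
      (\<lambda>\<zeta>. val (chart m \<sigma> \<zeta>)) sequentially" by (simp add: val_def)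
  fix x :: complex assume "x \<in> ball 0 1"
  then obtain d where "d > 0" "cball x d \<subseteq> ball 0 1"
    using open_contains_cball[of "ball (0::complex) 1"] open_ball by blast
  then show "\<exists>d>0. cball x d \<subseteq> ball 0 1 \<and> uniform_limit (cball x d)
      (\<lambda>n \<zeta>. \<Sum>k<n. of_real (e k) * chart m \<sigma> \<zeta> k) (\<lambda>\<zeta>. val (chart m \<sigma> \<zeta>)) sequentially"
    using uniform_limit_on_subset[OF ul] by blast
qed simp

lemma chart_in_X: "\<sigma> \<in> signs \<Longrightarrow> (A m + \<zeta>\<^sup>2, val (chart m \<sigma> \<zeta>)) \<in> X"
  using chart_roots by (auto simp: X_def)

section \<open>Monodromy and density of leaves\<close>

lemma leaf_invariantD:
  assumes "leaf_invariant P" "\<sigma> \<in> signs" "\<zeta> \<in> ball 0 1" "\<zeta>' \<in> ball 0 1" "P (chart m \<sigma> \<zeta>)"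
  shows "P (chart m \<sigma> \<zeta>')"
  using assms unfolding leaf_invariant_def by blast

text \<open>Monodromy around \<open>A m\<close>: one turn of z is half a turn of \<zeta>, which
  stays on the same chart disc and leaves all other roots unchanged.\<close>

lemma flip_chart_same: "flip m (chart m \<sigma> \<zeta>) = chart m \<sigma> (- \<zeta>)"
  by (auto simp: flip_def chart_def)

lemma flip_chart_other: "j \<noteq> m \<Longrightarrow> flip j (chart m \<sigma> \<zeta>) = chart m (flip j \<sigma>) \<zeta>"
  by (auto simp: flip_def chart_def)

lemma flip_signs: "\<sigma> \<in> signs \<Longrightarrow> flip j \<sigma> \<in> signs"
  by (auto simp: flip_def signs_def)

lemma flip_roots: "s \<in> roots z \<Longrightarrow> flip j s \<in> roots z"
  by (auto simp: flip_def roots_def)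

text \<open>Charts centred at neighbouring lattice points overlap over the midpoint \<open>b\<close>.\<close>

lemma neighbour_towards:
  assumes "m \<noteq> j"
  obtains m' \<zeta> b where "taxicab (A m' - A j) = taxicab (A m - A j) - 1"
    "\<zeta> \<in> ball 0 1" "b = A m + \<zeta>\<^sup>2" "cmod (b - A m') < 1"
proof -
  obtain c where c: "c \<in> gaussian_ints" "cmod (c - A m) = 1" "taxicab (c - A j) = taxicab (A m - A j) - 1"
    using gaussian_int_step_towards[OF A_mem A_mem, of m j] A_inj[of m j] assms by blast
  obtain m' where m': "A m' = c" using A_surj[OF c(1)] by blast
  define b where "b = (A m + A m') / 2"
  define \<zeta> where "\<zeta> = csqrt (b - A m)"
  have "b - A m = (c - A m) / 2" "b - A m' = (A m - c) / 2" by (simp_all add: b_def m' field_simps)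
  then have b: "cmod (b - A m) = 1/2" "cmod (b - A m') = 1/2"
    using c(2) by (simp_all only: norm_divide norm_minus_commute) auto
  have "\<zeta>\<^sup>2 = b - A m" by (simp add: \<zeta>_def)
  moreover from this have "(cmod \<zeta>)\<^sup>2 < 1\<^sup>2" using b(1) by (simp flip: norm_power)
  then have "cmod \<zeta> < 1" by (rule power2_less_imp_less) simp
  ultimately show ?thesis using that[of m' \<zeta> b] c(3) m' b(2) by simp
qed

text \<open>A discrete loop around \<open>A j\<close>: walk the lattice from \<open>A m\<close> to
  \<open>A j\<close>, change the sign there by \<zeta> -> -\<zeta>, and walk back. In the induction
  the flip is done at the neighbouring lattice point; for j different from m the result lies on the
  chart disc with the j-th sign reversed, along which one returns to the original
  coordinate.\<close>

lemma leaf_invariant_flip: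
  assumes inv: "leaf_invariant P"
  shows "taxicab (A m - A j) \<le> real N \<Longrightarrow> s \<in> roots z \<Longrightarrow> cmod (z - A m) < 1 \<Longrightarrow> P s \<Longrightarrow> P (flip j s)"
proof (induction N arbitrary: m s z)
  case (0 m s z)
  then have "A m = A j" using taxicab_le_0 by simp
  then have "m = j" by (simp add: A_inj)
  obtain \<sigma> where \<sigma>: "\<sigma> \<in> signs" "s = chart m \<sigma> (s m)" using chart_surj[OF 0(2,3)] by blast
  have "P (chart m \<sigma> (- s m))"
    using leaf_invariantD[OF inv \<sigma>(1), of "s m" "- s m" m] chart_surj(2)[OF 0(2,3)] 0(4) \<sigma>(2) by simp
  then show ?case using \<sigma>(2) flip_chart_same[of m \<sigma> "s m"] \<open>m = j\<close> by simp
next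
  case (Suc N m s z)
  obtain \<sigma> where \<sigma>: "\<sigma> \<in> signs" "s = chart m \<sigma> (s m)" using chart_surj[OF Suc.prems(2,3)] by blast
  have sm: "s m \<in> ball 0 1" by (rule chart_surj(2)[OF Suc.prems(2,3)])
  show ?case
  proof (cases "m = j")
    case True
    have "P (chart m \<sigma> (- s m))"
      using leaf_invariantD[OF inv \<sigma>(1), of "s m" "- s m" m] sm Suc.prems(4) \<sigma>(2) by simp
    then show ?thesis using \<sigma>(2) flip_chart_same[of m \<sigma> "s m"] True by simp
  next
    case False
    obtain m' \<zeta> b where m': "taxicab (A m' - A j) = taxicab (A m - A j) - 1"
      "\<zeta> \<in> ball 0 1" "b = A m + \<zeta>\<^sup>2" "cmod (b - A m') < 1"
      by (rule neighbour_towards[OF False])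
    have "P (chart m \<sigma> (s m))" using Suc.prems(4) \<sigma>(2) by simp
    then have "P (chart m \<sigma> \<zeta>)" by (rule leaf_invariantD[OF inv \<sigma>(1) sm m'(2)])
    then have "P (flip j (chart m \<sigma> \<zeta>))"
      using Suc.IH[of m' "chart m \<sigma> \<zeta>" b] Suc.prems(1) m' chart_roots[OF \<sigma>(1), of m \<zeta>] by simp
    then have "P (chart m (flip j \<sigma>) \<zeta>)" using False by (simp add: flip_chart_other)
    then have "P (chart m (flip j \<sigma>) (s m))"
      by (rule leaf_invariantD[OF inv flip_signs[OF \<sigma>(1)] m'(2) sm])
    then show ?thesis using \<sigma>(2) False flip_chart_other[of j m \<sigma> "s m"] by simp
  qed
qed

text \<open>The outward half of the same walk. The signs on arrival are left open, since flips
  correct them afterwards.\<close>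

lemma leaf_invariant_reach:
  assumes inv: "leaf_invariant P"
  shows "taxicab (A m - A j) \<le> real N \<Longrightarrow> \<exists>\<sigma>\<in>signs. P (chart m \<sigma> 0) \<Longrightarrow> \<exists>\<sigma>\<in>signs. P (chart j \<sigma> 0)"
proof (induction N arbitrary: m)
  case (0 m)
  then have "A m = A j" using taxicab_le_0 by simp
  then show ?case using 0 by (simp add: A_inj)
next
  case (Suc N m)
  show ?case
  proof (cases "m = j")
    case False
    obtain m' \<zeta> b where m': "taxicab (A m' - A j) = taxicab (A m - A j) - 1"
      "\<zeta> \<in> ball 0 1" "b = A m + \<zeta>\<^sup>2" "cmod (b - A m') < 1"
      by (rule neighbour_towards[OF False])
    obtain \<sigma> where \<sigma>: "\<sigma> \<in> signs" "P (chart m \<sigma> 0)" using Suc.prems by blast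
    define t where "t = chart m \<sigma> \<zeta>"
    have Pt: "P t" unfolding t_def by (rule leaf_invariantD[OF inv \<sigma>(1) _ m'(2) \<sigma>(2)]) simp
    have t: "t \<in> roots b" using chart_roots[OF \<sigma>(1)] m'(3) by (simp add: t_def)
    obtain \<tau> where \<tau>: "\<tau> \<in> signs" "t = chart m' \<tau> (t m')" using chart_surj[OF t m'(4)] by blast
    have "P (chart m' \<tau> 0)"
      using leaf_invariantD[OF inv \<tau>(1) chart_surj(2)[OF t m'(4)], of 0 m'] Pt \<tau>(2) by simp
    then show ?thesis using Suc.IH[of m'] Suc.prems(1) m'(1) \<tau>(1) by auto
  qed (use Suc.prems in simp)
qed

lemma taxicab_le_nat: "\<exists>N. taxicab z \<le> real N"
  using real_arch_simple by blast

text \<open>After transport to the fibre over z the roots are corrected in order of index: a wrong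
  n-th root is the negative of the right one, and flipping it leaves the earlier ones
  intact.\<close>

lemma leaf_invariant_dense:
  assumes inv: "leaf_invariant P" and s0: "s0 \<in> roots z0" "P s0" and s: "s \<in> roots z"
  shows "\<exists>t\<in>roots z. P t \<and> (\<forall>k<n. t k = s k)"
proof (induction n)
  case 0
  obtain m where m: "cmod (z0 - A m) < 1" using A_near by blast
  obtain j where j: "cmod (z - A j) < 1" using A_near by blast
  obtain \<sigma> where \<sigma>: "\<sigma> \<in> signs" "s0 = chart m \<sigma> (s0 m)" using chart_surj[OF s0(1) m] by blast
  have "P (chart m \<sigma> 0)"
    using leaf_invariantD[OF inv \<sigma>(1) chart_surj(2)[OF s0(1) m], of 0 m] s0(2) \<sigma>(2) by simp
  then obtain \<tau> where \<tau>: "\<tau> \<in> signs" "P (chart j \<tau> 0)"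
    using leaf_invariant_reach[OF inv, of m j] taxicab_le_nat \<sigma>(1) by metis
  have sj: "s j \<in> ball 0 1" "z = A j + (s j)\<^sup>2" using chart_surj(2,3)[OF s j] .
  have "P (chart j \<tau> (s j))" by (rule leaf_invariantD[OF inv \<tau>(1) _ sj(1) \<tau>(2)]) simp
  moreover have "chart j \<tau> (s j) \<in> roots z" using chart_roots[OF \<tau>(1)] sj(2) by metis
  ultimately show ?case by auto
next
  case (Suc n)
  then obtain t where t: "t \<in> roots z" "P t" "\<forall>k<n. t k = s k" by blast
  have "t n = s n \<or> t n = - s n"
    using rootsD[OF t(1), of n] rootsD[OF s, of n] power2_eq_iff by metis
  then show ?case
  proof
    assume "t n = s n"
    then show ?thesis using t less_Suc_eq by auto
  next
    assume n: "t n = - s n"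
    obtain m where "cmod (z - A m) < 1" using A_near by blast
    then have "P (flip n t)"
      using leaf_invariant_flip[OF inv _ t(1) _ t(2), of m n] taxicab_le_nat by metis
    moreover have "\<forall>k<Suc n. flip n t k = s k" using t(3) n by (auto simp: flip_def less_Suc_eq)
    ultimately show ?thesis using flip_roots[OF t(1)] by blast
  qed
qed

lemma leaf_invariant_seq:
  assumes inv: "leaf_invariant P" and s0: "s0 \<in> roots z0" "P s0" and s: "s \<in> roots z"
  shows "\<exists>t. (\<forall>n. t n \<in> roots z \<and> P (t n)) \<and> (\<lambda>n. (z, val (t n))) \<longlonglongrightarrow> (z, val s)"
proof -
  obtain t where t: "\<And>n. t n \<in> roots z \<and> P (t n) \<and> (\<forall>k<n. t n k = s k)"
    using leaf_invariant_dense[OF assms] by metis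
  have "cmod (val (t n) - val s) \<le> 4 * (1 + cmod z) * (1/2) ^ n" for n
    using t s by (intro val_close[of _ z]) auto
  then have "(\<lambda>n. cmod (val (t n) - val s)) \<longlonglongrightarrow> 0"
    by (intro tendsto_sandwich[OF _ _ tendsto_const bound_tendsto_0[of "4 * (1 + cmod z)"]]) auto
  then have "(\<lambda>n. val (t n)) \<longlonglongrightarrow> val s"
    by (metis LIM_zero_iff tendsto_norm_zero_iff)
  then show ?thesis using t by (intro exI[of _ t]) (auto intro!: tendsto_intros)
qed

section \<open>Connectedness\<close>

text \<open>The image of a chart disc is connected, so it lies in one side of a separation, and
  membership in that side is leaf invariant. A leaf in U then accumulates at a point of the open set
  W and enters it.\<close>

lemma connected_X: "connected X"
proof (rule ccontr)
  assume "\<not> connected X"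
  then obtain U W where UW: "open U" "open W" "X \<subseteq> U \<union> W" "U \<inter> W \<inter> X = {}" "U \<inter> X \<noteq> {}" "W \<inter> X \<noteq> {}"
    unfolding connected_def by blast
  define pt where "pt s = ((s 0)\<^sup>2 + A 0, val s)" for s
  have pt: "pt s = (z, val s)" if "s \<in> roots z" for s z
    using rootsD[OF that, of 0] by (simp add: pt_def)
  define P where "P s \<longleftrightarrow> pt s \<in> U" for s
  have "leaf_invariant P"
    unfolding leaf_invariant_def
  proof (intro allI ballI impI)
    fix m \<sigma> and \<zeta> \<zeta>' :: complex assume \<sigma>: "\<sigma> \<in> signs" and \<zeta>: "\<zeta> \<in> ball 0 1" "\<zeta>' \<in> ball 0 1" and P: "P (chart m \<sigma> \<zeta>)"
    define F where "F \<zeta> = (A m + \<zeta>\<^sup>2, val (chart m \<sigma> \<zeta>))" for \<zeta>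
    have pF: "pt (chart m \<sigma> \<zeta>) = F \<zeta>" for \<zeta> using pt[OF chart_roots[OF \<sigma>]] by (simp add: F_def)
    have "continuous_on (ball 0 1) F"
      unfolding F_def
      by (intro continuous_intros holomorphic_on_imp_continuous_on val_chart_holomorphic \<sigma>)
    then have "connected (F ` ball 0 1)" by (rule connected_continuous_image) simp
    moreover have "F ` ball 0 1 \<subseteq> X" using chart_in_X[OF \<sigma>] by (auto simp: F_def)
    moreover have "U \<inter> F ` ball 0 1 \<noteq> {}" using P \<zeta>(1) pF by (auto simp: P_def)
    ultimately have "W \<inter> F ` ball 0 1 = {}"
      using connectedD[of "F ` ball 0 1" U W] UW(1-4) by blast
    then have "F \<zeta>' \<in> U" using \<zeta>(2) \<open>F ` ball 0 1 \<subseteq> X\<close> UW(3) by blast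
    then show "P (chart m \<sigma> \<zeta>')" by (simp add: P_def pF)
  qed
  moreover obtain z0 s0 where "s0 \<in> roots z0" "(z0, val s0) \<in> U" using UW(5) by (auto simp: X_def)
  moreover obtain z s where s: "s \<in> roots z" "(z, val s) \<in> W" using UW(6) by (auto simp: X_def)
  ultimately obtain t where t: "\<And>n. t n \<in> roots z" "\<And>n. P (t n)" "(\<lambda>n. (z, val (t n))) \<longlonglongrightarrow> (z, val s)"
    using leaf_invariant_seq[of P s0 z0 s z] by (auto simp: P_def pt)
  then obtain n where "(z, val (t n)) \<in> W"
    using topological_tendstoD[OF t(3) UW(2) s(2)] eventually_sequentially by auto
  moreover have "(z, val (t n)) \<in> U" using t(1,2)[of n] by (simp add: P_def pt)
  moreover have "(z, val (t n)) \<in> X" using t(1) by (auto simp: X_def)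
  ultimately show False using UW(4) by blast
qed

section \<open>Plurisubharmonic functions on the limit set\<close>

text \<open>The maximum over |z| \<le> 1 turns out to be global. A larger value at q survives
  subtracting a small multiple of ln |z|; that term vanishes on |z| = 1 and beats the bound M on a
  large circle, so neither boundary circle carries the maximum.\<close>

lemma psh_attains_sup:
  assumes XV: "X \<subseteq> V" and psh: "cont_psh_on V \<phi>" and M: "\<And>x. x \<in> V \<Longrightarrow> \<phi> x \<le> M"
  shows "\<exists>p\<in>X. \<forall>q\<in>X. \<phi> q \<le> \<phi> p"
proof -
  have contV: "continuous_on V \<phi>" using psh unfolding cont_psh_on_def by blast
  have contX: "continuous_on S \<phi>" if "S \<subseteq> X" for S
    using that XV by (intro continuous_on_subset[OF contV]) auto
  define X1 where "X1 = {p \<in> X. cmod (fst p) \<le> 1}"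
  have "X1 \<noteq> {}" using X_over[of 0] by (auto simp: X1_def)
  then obtain p1 where p1: "p1 \<in> X1" "\<And>q. q \<in> X1 \<Longrightarrow> \<phi> q \<le> \<phi> p1"
    using continuous_attains_sup[OF compact_X_part[of 1] _ contX] unfolding X1_def by (metis (no_types, lifting) mem_Collect_eq subsetI)
  have "\<phi> q \<le> \<phi> p1" if q: "q \<in> X" for q
  proof (rule ccontr)
    assume less: "\<not> \<phi> q \<le> \<phi> p1"
    then have q1: "1 < cmod (fst q)" using p1(2)[of q] q by (force simp: X1_def)
    \<comment> \<open>Liouville by comparison with \<open>\<eta> ln |z|\<close>, which is harmonic on the leaves away from \<open>z = 0\<close>.\<close>
    define \<eta> where "\<eta> = (\<phi> q - \<phi> p1) / (2 * ln (cmod (fst q)))"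
    have \<eta>: "\<eta> > 0" "\<eta> * ln (cmod (fst q)) = (\<phi> q - \<phi> p1) / 2" using less ln_gt_zero[OF q1] by (auto simp: \<eta>_def)
    define \<Phi> where "\<Phi> p = \<phi> p - \<eta> * ln (cmod (fst p))" for p
    have \<Phi>q: "\<Phi> q > \<phi> p1" using less \<eta>(2) by (simp add: \<Phi>_def field_simps)
    \<comment> \<open>The exponential makes \<eta> ln R exceed M - \<phi>(p1), which rules out the
      outer circle; the other entry keeps q in the annulus.\<close>
    define R where "R = max (cmod (fst q)) (exp ((M - \<phi> p1) / \<eta> + 1))"
    have "ln R \<ge> (M - \<phi> p1) / \<eta> + 1" by (subst ln_ge_iff) (auto simp: R_def less_max_iff_disj)
    then have R: "\<eta> * ln R > M - \<phi> p1" using \<eta>(1) by (simp add: field_simps)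
    define Y where "Y = {p \<in> X. cmod (fst p) \<le> R} \<inter> {p. 1 \<le> cmod (fst p)}"
    have cY: "compact Y" unfolding Y_def
      by (intro compact_Int_closed compact_X_part closed_Collect_le continuous_intros)
    have qY: "q \<in> Y" using q q1 by (simp add: Y_def R_def)
    have c\<Phi>: "continuous_on Y \<Phi>" unfolding \<Phi>_def
      by (intro continuous_intros contX) (auto simp: Y_def)
    then obtain pm where pm: "pm \<in> Y" "\<And>p. p \<in> Y \<Longrightarrow> \<Phi> p \<le> \<Phi> pm"
      using continuous_attains_sup[OF cY] qY by blast
    \<comment> \<open>Among the maximum points one with |z| largest is taken. Constancy of
      \<open>\<Phi>\<close> along the leaf makes the nearby points maximum points as well, so |z|
      has a local maximum on the leaf, against the maximum modulus principle.\<close>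
    define Z where "Z = {p \<in> Y. \<Phi> p = \<Phi> pm}"
    have "closed Z" unfolding Z_def
      by (rule continuous_closed_preimage_constant[OF c\<Phi> compact_imp_closed[OF cY]])
    then have "compact Z"
      using compact_Int_closed[OF cY, of Z] by (simp add: Z_def Int_def conj_ac cong: conj_cong)
    moreover have "pm \<in> Z" using pm(1) by (simp add: Z_def)
    moreover have "continuous_on Z (\<lambda>p. cmod (fst p))" by (intro continuous_intros)
    ultimately obtain p where p: "p \<in> Z" "\<And>p'. p' \<in> Z \<Longrightarrow> cmod (fst p') \<le> cmod (fst p)"
      using continuous_attains_sup[of Z "\<lambda>p. cmod (fst p)"] by blast
    have pY: "p \<in> Y" "\<Phi> p = \<Phi> pm" using p(1) by (auto simp: Z_def)
    have \<Phi>p: "\<Phi> p > \<phi> p1" using pm(2)[OF qY] \<Phi>q pY by simp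
    have "cmod (fst p) \<noteq> 1"
    proof
      assume "cmod (fst p) = 1"
      then have "\<Phi> p \<le> \<phi> p1" using p1(2)[of p] pY by (simp add: \<Phi>_def X1_def Y_def)
      then show False using \<Phi>p by simp
    qed
    moreover have "cmod (fst p) \<noteq> R"
    proof
      assume "cmod (fst p) = R"
      then have "\<Phi> p \<le> M - \<eta> * ln R" using M[of p] pY XV by (auto simp: \<Phi>_def Y_def)
      then show False using \<Phi>p R by simp
    qed
    ultimately have pR: "1 < cmod (fst p)" "cmod (fst p) < R" using pY by (auto simp: Y_def)
    obtain z s where zs: "p = (z, val s)" "s \<in> roots z" using pY by (auto simp: Y_def X_def)
    obtain m where m: "cmod (z - A m) < 1" using A_near by blast
    obtain \<sigma> where \<sigma>: "\<sigma> \<in> signs" "s = chart m \<sigma> (s m)" using chart_surj(1)[OF zs(2) m] by blast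
    define F1 where "F1 \<zeta> = A m + \<zeta>\<^sup>2" for \<zeta>
    define F2 where "F2 \<zeta> = val (chart m \<sigma> \<zeta>)" for \<zeta>
    have sm: "s m \<in> ball 0 1" "z = F1 (s m)" "F2 (s m) = val s"
      using chart_surj(2,3)[OF zs(2) m] \<sigma>(2) by (simp_all add: F1_def F2_def)
    \<comment> \<open>Keeps the disc over the open annulus; since d < |z|, it also keeps
      \<open>F1 \<zeta> / z\<close> in the right half-plane.\<close>
    define d where "d = min (cmod z - 1) (R - cmod z)"
    have d: "d > 0" using pR zs(1) by (simp add: d_def)
    have "open (ball 0 1 \<inter> {\<zeta>. cmod (F1 \<zeta> - z) < d})"
      unfolding F1_def by (intro open_Int open_ball open_Collect_less continuous_intros)
    moreover have "s m \<in> ball 0 1 \<inter> {\<zeta>. cmod (F1 \<zeta> - z) < d}" using sm d by simp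
    ultimately obtain r where r: "r > 0" "ball (s m) r \<subseteq> ball 0 1 \<inter> {\<zeta>. cmod (F1 \<zeta> - z) < d}"
      using open_contains_ball by metis
    define U where "U = ball (s m) r"
    have smU: "s m \<in> U" using r by (simp add: U_def)
    have F1d: "cmod (F1 \<zeta> - z) < d" if "\<zeta> \<in> U" for \<zeta> using that r by (auto simp: U_def)
    have FX: "(F1 \<zeta>, F2 \<zeta>) \<in> X" for \<zeta> unfolding F1_def F2_def by (rule chart_in_X[OF \<sigma>(1)])
    have FY: "(F1 \<zeta>, F2 \<zeta>) \<in> Y" if "\<zeta> \<in> U" for \<zeta>
      using F1d[OF that] FX[of \<zeta>] norm_triangle_ineq2[of "F1 \<zeta>" z] norm_triangle_ineq3[of "F1 \<zeta>" z]
      by (auto simp: Y_def d_def)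
    have hol1: "F1 holomorphic_on U" unfolding F1_def by (intro holomorphic_intros)
    have hol2: "F2 holomorphic_on U" unfolding F2_def
      by (rule holomorphic_on_subset[OF val_chart_holomorphic[OF \<sigma>(1)]]) (use r in \<open>auto simp: U_def\<close>)
    have z0: "z \<noteq> 0" using pR zs(1) by auto
    have pos: "Re (F1 \<zeta> / z) > 0" if "\<zeta> \<in> U" for \<zeta>
    proof -
      have "cmod ((F1 \<zeta> - z) / z) < 1"
        using F1d[OF that] z0 by (simp add: norm_divide d_def)
      moreover have "F1 \<zeta> / z = 1 + (F1 \<zeta> - z) / z" using z0 by (simp add: field_simps)
      ultimately show ?thesis using abs_Re_le_cmod[of "(F1 \<zeta> - z) / z"] by simp
    qed
    \<comment> \<open>Dividing by z keeps \<open>Ln\<close> off its cut and changes Re g only by a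
      constant against -\<eta> ln |F1|.\<close>
    define g where "g \<zeta> = - of_real \<eta> * Ln (F1 \<zeta> / z)" for \<zeta>
    have hol3: "g holomorphic_on U" unfolding g_def using pos z0
      by (intro holomorphic_intros hol1) (auto simp: complex_nonpos_Reals_iff not_le)
    have Reg: "\<phi> (F1 \<zeta>, F2 \<zeta>) + Re (g \<zeta>) = \<Phi> (F1 \<zeta>, F2 \<zeta>) + \<eta> * ln (cmod z)" if "\<zeta> \<in> U" for \<zeta>
    proof -
      have ne: "F1 \<zeta> / z \<noteq> 0" "F1 \<zeta> \<noteq> 0" using pos[OF that] by auto
      have "Re (Ln (F1 \<zeta> / z)) = ln (cmod (F1 \<zeta>)) - ln (cmod z)"
        unfolding Re_Ln[OF ne(1)] using ne(2) z0 by (simp add: norm_divide ln_div)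
      then show ?thesis by (simp add: g_def \<Phi>_def right_diff_distrib)
    qed
    have "\<phi> (F1 \<zeta>, F2 \<zeta>) + Re (g \<zeta>) = \<Phi> pm + \<eta> * ln (cmod z)" if "\<zeta> \<in> U" for \<zeta>
    proof (rule psh_strong_max_principle[OF psh hol1 hol2 hol3 _ _ _ _ smU _ that])
      show "\<phi> (F1 (s m), F2 (s m)) + Re (g (s m)) = \<Phi> pm + \<eta> * ln (cmod z)"
        unfolding Reg[OF smU] using sm zs pY(2) by simp
      show "\<phi> (F1 \<zeta>, F2 \<zeta>) + Re (g \<zeta>) \<le> \<Phi> pm + \<eta> * ln (cmod z)" if "\<zeta> \<in> U" for \<zeta>
        unfolding Reg[OF that] using pm(2)[OF FY[OF that]] by simp
    qed (use FX XV in \<open>auto simp: U_def\<close>)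
    then have "(F1 \<zeta>, F2 \<zeta>) \<in> Z" if "\<zeta> \<in> U" for \<zeta>
      using that FY[OF that] Reg[OF that] by (simp add: Z_def)
    then have "cmod (F1 \<zeta>) \<le> cmod (F1 (s m))" if "\<zeta> \<in> U" for \<zeta>
      using p(2) that zs(1) sm(2) by fastforce
    then have "F1 constant_on U"
      by (intro maximum_modulus_principle[OF hol1 _ _ _ _ smU]) (auto simp: U_def)
    then obtain c where c: "\<And>\<zeta>. \<zeta> \<in> U \<Longrightarrow> F1 \<zeta> = c" by (auto simp: constant_on_def)
    \<comment> \<open>The second difference of A m + \<zeta>^2 is 2 \<tau>^2. It excludes constancy
      even at the branch point s m = 0, where the derivative vanishes.\<close>
    define \<tau> where "\<tau> = complex_of_real (r / 2)"
    have "s m + \<tau> \<in> U" "s m - \<tau> \<in> U" using r by (auto simp: U_def \<tau>_def dist_norm norm_divide)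
    then have "F1 (s m + \<tau>) + F1 (s m - \<tau>) = 2 * F1 (s m)" using c smU by simp
    then have "\<tau>\<^sup>2 = 0" by (simp add: F1_def power2_eq_square algebra_simps)
    then show False using r by (simp add: \<tau>_def)
  qed
  then show ?thesis using p1(1) unfolding X1_def by blast
qed

lemma psh_constant:
  assumes XV: "X \<subseteq> V" and psh: "cont_psh_on V \<phi>" and M: "\<And>x. x \<in> V \<Longrightarrow> \<phi> x \<le> M"
  shows "\<exists>C. \<forall>x\<in>X. \<phi> x = C"
proof -
  obtain p where p: "p \<in> X" "\<And>q. q \<in> X \<Longrightarrow> \<phi> q \<le> \<phi> p" using psh_attains_sup[OF assms] by blast
  obtain z0 s0 where s0: "p = (z0, val s0)" "s0 \<in> roots z0" using p(1) by (auto simp: X_def)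
  define pt where "pt s = ((s 0)\<^sup>2 + A 0, val s)" for s
  have pt: "pt s = (z, val s)" if "s \<in> roots z" for s z
    using rootsD[OF that, of 0] by (simp add: pt_def)
  define P where "P s \<longleftrightarrow> \<phi> (pt s) = \<phi> p" for s
  have inv: "leaf_invariant P"
    unfolding leaf_invariant_def
  proof (intro allI ballI impI)
    fix m \<sigma> and \<zeta> \<zeta>' :: complex
    assume \<sigma>: "\<sigma> \<in> signs" and \<zeta>: "\<zeta> \<in> ball 0 1" "\<zeta>' \<in> ball 0 1" and P: "P (chart m \<sigma> \<zeta>)"
    have pF: "pt (chart m \<sigma> \<zeta>) = (A m + \<zeta>\<^sup>2, val (chart m \<sigma> \<zeta>))" for \<zeta> using pt[OF chart_roots[OF \<sigma>]] .
    have "\<phi> (A m + \<zeta>'\<^sup>2, val (chart m \<sigma> \<zeta>')) + Re 0 = \<phi> p"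
    proof (rule psh_strong_max_principle[OF psh _ val_chart_holomorphic[OF \<sigma>] _ _ _ _ _ \<zeta>(1) _ \<zeta>(2),
          where g = "\<lambda>_. 0" and ?f1.0 = "\<lambda>\<zeta>. A m + \<zeta>\<^sup>2"])
      show "(A m + \<zeta>\<^sup>2, val (chart m \<sigma> \<zeta>)) \<in> V" for \<zeta> using chart_in_X[OF \<sigma>] XV by blast
      show "\<phi> (A m + \<zeta>\<^sup>2, val (chart m \<sigma> \<zeta>)) + Re 0 \<le> \<phi> p" for \<zeta>
        using p(2)[OF chart_in_X[OF \<sigma>]] by simp
    qed (use P in \<open>auto simp: P_def pF intro!: holomorphic_intros\<close>)
    then show "P (chart m \<sigma> \<zeta>')" by (simp add: P_def pF)
  qed
  have P0: "P s0" using s0 by (simp add: P_def pt)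
  have "\<phi> x = \<phi> p" if x: "x \<in> X" for x
  proof -
    obtain z s where s: "x = (z, val s)" "s \<in> roots z" using x by (auto simp: X_def)
    obtain t where t: "\<And>n. t n \<in> roots z" "\<And>n. P (t n)" "(\<lambda>n. (z, val (t n))) \<longlonglongrightarrow> (z, val s)"
      using leaf_invariant_seq[OF inv s0(2) P0 s(2)] by blast
    have "continuous_on X \<phi>" using psh XV continuous_on_subset unfolding cont_psh_on_def by blast
    then have "(\<lambda>n. \<phi> (z, val (t n))) \<longlonglongrightarrow> \<phi> x"
      using t(1,3) s x by (intro continuous_on_tendsto_compose[of X \<phi>] always_eventually) (auto simp: X_def)
    moreover have "\<phi> (z, val (t n)) = \<phi> p" for n using t(1,2)[of n] by (simp add: P_def pt)
    ultimately have "(\<lambda>n. \<phi> p) \<longlonglongrightarrow> \<phi> x" by simp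
    then show ?thesis using LIMSEQ_unique tendsto_const by blast
  qed
  then show ?thesis by blast
qed

section \<open>Specialisation to the spiral\<close>

lemma wermer_E_eq_trunc:
  assumes "\<And>k. A k = a (Suc k)" "\<And>k. e k = \<epsilon> (Suc k)"
  shows "wermer_E a \<epsilon> n = trunc n"
proof -
  have "(\<exists>s. (\<forall>k\<in>{1..n}. (s k)\<^sup>2 = z - a k) \<and> w = (\<Sum>k=1..n. of_real (\<epsilon> k) * s k)) \<longleftrightarrow>
      (\<exists>s. (\<forall>k<n. (s k)\<^sup>2 = z - A k) \<and> w = (\<Sum>k<n. of_real (e k) * s k))" for z w
  proof (intro iffI; elim exE conjE)
    fix s assume "\<forall>k\<in>{1..n}. (s k)\<^sup>2 = z - a k" "w = (\<Sum>k=1..n. of_real (\<epsilon> k) * s k)"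
    then show "\<exists>s. (\<forall>k<n. (s k)\<^sup>2 = z - A k) \<and> w = (\<Sum>k<n. of_real (e k) * s k)"
      by (intro exI[of _ "\<lambda>k. s (Suc k)"]) (auto simp: assms sum.atLeast1_atMost_eq)
  next
    fix s assume s: "\<forall>k<n. (s k)\<^sup>2 = z - A k" "w = (\<Sum>k<n. of_real (e k) * s k)"
    have "(s (k - 1))\<^sup>2 = z - a k" if "k \<in> {1..n}" for k
      using s(1)[rule_format, of "k - 1"] that assms(1)[of "k - 1"] by (cases k) auto
    then show "\<exists>s. (\<forall>k\<in>{1..n}. (s k)\<^sup>2 = z - a k) \<and> w = (\<Sum>k=1..n. of_real (\<epsilon> k) * s k)"
      using s(2) by (intro exI[of _ "\<lambda>k. s (k - 1)"]) (auto simp: assms sum.atLeast1_atMost_eq)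
  qed
  then show ?thesis unfolding wermer_E_def trunc_def by simp
qed

end

theorem theorem6p1:
  shows "\<exists>eps :: nat \<Rightarrow> real.
    (\<forall>n. 0 < eps n) \<and> (\<forall>n. eps (Suc n) < eps n) \<and> eps \<longlonglongrightarrow> 0 \<and>
    (let E = wermer_E spiral eps; \<E> = wermer_limit E in
      local_hausdorff_tendsto E \<E> \<and>
      \<E> \<noteq> {} \<and> \<not> bounded \<E> \<and> connected \<E> \<and> closed \<E> \<and>
      (\<forall>V \<phi>. open V \<longrightarrow> \<E> \<subseteq> V \<longrightarrow> cont_psh_on V \<phi> \<longrightarrow> (\<exists>M. \<forall>x\<in>V. \<phi> x \<le> M) \<longrightarrow>
          (\<exists>C::real. \<forall>x\<in>\<E>. \<phi> x = C)))"
proof -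
  \<comment> \<open>The factor 1/(n + 1) absorbs the linear bound on the spiral points; the power of
    1/2 remains as geometric majorant.\<close>
  define eps :: "nat \<Rightarrow> real" where "eps n = (1/2) ^ n / (real n + 1)" for n
  have pos: "0 < eps n" for n by (simp add: eps_def)
  have dec: "eps (Suc n) < eps n" for n
  proof -
    have "(1/2::real) ^ Suc n / (real (Suc n) + 1) < (1/2) ^ n / (real (Suc n) + 1)"
      by (intro divide_strict_right_mono) auto
    also have "\<dots> \<le> (1/2) ^ n / (real n + 1)" by (intro divide_left_mono) auto
    finally show ?thesis by (simp only: eps_def)
  qed
  have "eps n \<le> (1/2) ^ n" for n
    unfolding eps_def using divide_left_mono[of 1 "real n + 1" "(1/2::real) ^ n"] by simp
  then have lim: "eps \<longlonglongrightarrow> 0"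
    using pos by (intro tendsto_sandwich[OF _ _ tendsto_const LIMSEQ_power_zero[of "1/2::real"]])
      (auto intro!: always_eventually less_imp_le)
  interpret wermer_data "\<lambda>k. spiral (Suc k)" "\<lambda>k. eps (Suc k)"
  proof
    fix k
    have ne: "real (Suc k) + 1 \<noteq> 0" by linarith
    have "eps (Suc k) * (1 + cmod (spiral (Suc k))) \<le> eps (Suc k) * (real (Suc k) + 1)"
      using norm_spiral_le[of k] pos[of "Suc k"] by (intro mult_left_mono) auto
    also have "\<dots> = (1/2) ^ Suc k" 
      unfolding eps_def by (simp only: times_divide_eq_left nonzero_mult_div_cancel_right[OF ne])
    also have "\<dots> \<le> (1/2) ^ k" by simp
    finally show "eps (Suc k) * (1 + cmod (spiral (Suc k))) \<le> (1/2) ^ k" .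
  qed (use bij_betw_spiral pos in auto)
  have E: "wermer_E spiral eps n = trunc n" for n by (rule wermer_E_eq_trunc) auto
  have lim_eq: "wermer_limit (wermer_E spiral eps) = X" using E by (rule wermer_limit_eq_X)
  show ?thesis
    unfolding Let_def
  proof (intro exI[of _ eps] conjI)
    show "local_hausdorff_tendsto (wermer_E spiral eps) (wermer_limit (wermer_E spiral eps))"
      unfolding lim_eq using E by (rule local_hausdorff_tendsto_X)
    show "\<forall>V \<phi>. open V \<longrightarrow> wermer_limit (wermer_E spiral eps) \<subseteq> V \<longrightarrow> cont_psh_on V \<phi> \<longrightarrow>
        (\<exists>M. \<forall>x\<in>V. \<phi> x \<le> M) \<longrightarrow> (\<exists>C::real. \<forall>x\<in>wermer_limit (wermer_E spiral eps). \<phi> x = C)"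
      unfolding lim_eq using psh_constant by blast
  qed (use pos dec lim X_nonempty X_unbounded connected_X closed_X in \<open>simp_all add: lim_eq\<close>)
qed

end
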